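(* Let $\rho>0$ and $\mathrm{D}_{\varphi_1}=\mathrm{D}_{\varphi_2}=\rho\,\mathrm{KL}$. Let $p\in[1,+\infty)$, $\mathrm{C}_1(x,y)=|x-y|^p$ on $\mathbb{R}$, $\mathrm{C}_d(x,y)=\|x-y\|^p$ on $\mathbb{R}^d$. Let $\mathsf{X}\subset\mathbb{R}^d$ be compact, contained in the ball of radius $R>0$ centered at the origin, and let $(\alpha_n)_{n\ge1}$ be a sequence in $\mathcal{M}_+(\mathsf{X})$ and $\alpha\in\mathcal{M}_+(\mathsf{X})$. Then $$\alpha_n\rightharpoonup\alpha\iff\lim_{n\to\infty}\mathrm{SUOT}(\alpha_n,\alpha)=0\iff\lim_{n\to\infty}\mathrm{USOT}(\alpha_n,\alpha)=0.$$
   Context: $\alpha_n\rightharpoonup\alpha$ means $\int f\,d\alpha_n\to\int f\,d\alpha$ for every continuous $f:\mathbb{R}^d\to\mathbb{R}$. $\mathcal{M}_+(\mathsf{X})$: positive Radon measures supported in $\mathsf{X}$. For an entropy function $\varphi$, $\mathrm{D}_\varphi(\mu|\nu)=\int\varphi(\frac{d\mu}{d\nu})d\nu+\varphi'_\infty\mu^\perp(\mathbb{R}^s)$ ($\mu^\perp$ singular part of $\mu$ w.r.t. $\nu$, $\varphi'_\infty=\lim\varphi(x)/x$); $\rho\,\mathrm{KL}$ corresponds to $\varphi(x)=\rho(x\log x-x+1)$. $\mathrm{UOT}(\mu,\nu)=\inf_{\pi\ge0}\int C\,d\pi+\mathrm{D}_{\varphi_1}(\pi_1|\mu)+\mathrm{D}_{\varphi_2}(\pi_2|\nu)$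 with $\pi_1,\pi_2$ the marginals of $\pi$; on $\mathbb{R}$ the cost is $\mathrm{C}_1$. $\mathrm{OT}$ is balanced OT with cost $\mathrm{C}_1$ (value $+\infty$ if masses differ). With $\boldsymbol{\sigma}$ uniform on $\mathbb{S}^{d-1}$, $\theta^\star(x)=\langle\theta,x\rangle$: $\mathrm{SOT}(\alpha,\beta)=\int\mathrm{OT}(\theta^\star_\sharp\alpha,\theta^\star_\sharp\beta)d\boldsymbol{\sigma}$, $\mathrm{SUOT}(\alpha,\beta)=\int\mathrm{UOT}(\theta^\star_\sharp\alpha,\theta^\star_\sharp\beta)d\boldsymbol{\sigma}$, $\mathrm{USOT}(\alpha,\beta)=\inf_{\pi_1,\pi_2\in\mathcal{M}_+(\mathbb{R}^d)}\mathrm{SOT}(\pi_1,\pi_2)+\mathrm{D}_{\varphi_1}(\pi_1|\alpha)+\mathrm{D}_{\varphi_2}(\pi_2|\beta)$. *)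

theory Defs
  imports "HOL-Probability.Probability"
begin

definition Mplus :: "'a::euclidean_space set \<Rightarrow> 'a measure set" where
  "Mplus X = {M. sets M = sets borel \<and> finite_measure M \<and> emeasure M (UNIV - X) = 0}"

definition weak_conv :: "(nat \<Rightarrow> 'a::euclidean_space measure) \<Rightarrow> 'a measure \<Rightarrow> bool" where
  "weak_conv as a \<longleftrightarrow> (\<forall>f :: 'a \<Rightarrow> real. continuous_on UNIV f \<longrightarrow>
      (\<lambda>n. integral\<^sup>L (as n) f) \<longlonglongrightarrow> integral\<^sup>L a f)"

definition phi_KL :: "real \<Rightarrow> real \<Rightarrow> real" where
  "phi_KL \<rho> x = \<rho> * (x * ln x - x + 1)"

text \<open>D_phi(mu|nu) for phi = rho KL. Since phi'_infinity = +infinity, the term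
  phi'_infinity * mu^perp(R^s) is +infinity unless mu is absolutely continuous w.r.t. nu.\<close>
definition KLdiv :: "real \<Rightarrow> 'b measure \<Rightarrow> 'b measure \<Rightarrow> ennreal" where
  "KLdiv \<rho> \<mu> \<nu> = (if sets \<mu> = sets \<nu> \<and> absolutely_continuous \<nu> \<mu>
      then (\<integral>\<^sup>+ x. ennreal (phi_KL \<rho> (enn2real (RN_deriv \<nu> \<mu> x))) \<partial>\<nu>)
      else \<top>)"

definition cost1 :: "real \<Rightarrow> real \<times> real \<Rightarrow> real" where
  "cost1 p z = \<bar>fst z - snd z\<bar> powr p"

text \<open>Balanced OT on R (value +infinity if no coupling exists, e.g. masses differ).\<close>
definition OT :: "real \<Rightarrow> real measure \<Rightarrow> real measure \<Rightarrow> ennreal" where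
  "OT p \<mu> \<nu> = (INF \<pi> \<in> {\<pi> :: (real \<times> real) measure. sets \<pi> = sets borel \<and>
        distr \<pi> borel fst = \<mu> \<and> distr \<pi> borel snd = \<nu>}.
      \<integral>\<^sup>+ z. ennreal (cost1 p z) \<partial>\<pi>)"

definition UOT :: "real \<Rightarrow> real \<Rightarrow> real measure \<Rightarrow> real measure \<Rightarrow> ennreal" where
  "UOT \<rho> p \<mu> \<nu> = (INF \<pi> \<in> {\<pi> :: (real \<times> real) measure. sets \<pi> = sets borel \<and> finite_measure \<pi>}.
      (\<integral>\<^sup>+ z. ennreal (cost1 p z) \<partial>\<pi>) + KLdiv \<rho> (distr \<pi> borel fst) \<mu>
        + KLdiv \<rho> (distr \<pi> borel snd) \<nu>)"

definition sphere_unif :: "'a::euclidean_space measure" where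
  "sphere_unif = distr (uniform_measure lborel (ball 0 1)) borel (\<lambda>x. x /\<^sub>R norm x)"

definition proj :: "'a::euclidean_space \<Rightarrow> 'a measure \<Rightarrow> real measure" where
  "proj \<theta> \<alpha> = distr \<alpha> borel (\<lambda>x. \<theta> \<bullet> x)"

definition SOT :: "real \<Rightarrow> 'a::euclidean_space measure \<Rightarrow> 'a measure \<Rightarrow> ennreal" where
  "SOT p \<alpha> \<beta> = (\<integral>\<^sup>+ \<theta>. OT p (proj \<theta> \<alpha>) (proj \<theta> \<beta>) \<partial>sphere_unif)"

definition SUOT :: "real \<Rightarrow> real \<Rightarrow> 'a::euclidean_space measure \<Rightarrow> 'a measure \<Rightarrow> ennreal" where
  "SUOT \<rho> p \<alpha> \<beta> = (\<integral>\<^sup>+ \<theta>. UOT \<rho> p (proj \<theta> \<alpha>) (proj \<theta> \<beta>) \<partial>sphere_unif)"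

definition USOT :: "real \<Rightarrow> real \<Rightarrow> 'a::euclidean_space measure \<Rightarrow> 'a measure \<Rightarrow> ennreal" where
  "USOT \<rho> p \<alpha> \<beta> = (INF \<pi> \<in> {\<pi> :: 'a measure \<times> 'a measure.
        sets (fst \<pi>) = sets borel \<and> finite_measure (fst \<pi>) \<and>
        sets (snd \<pi>) = sets borel \<and> finite_measure (snd \<pi>)}.
      SOT p (fst \<pi>) (snd \<pi>) + KLdiv \<rho> (fst \<pi>) \<alpha> + KLdiv \<rho> (snd \<pi>) \<beta>)"

end

(* Weak duality for the entropic problem bounds UOT in a direction theta, and also
   OT + KL + KL, from below by the dual value of any pair f, g with f(x) + g(y) <= |x - y|^p.
   Taking f = s u and g = - s u - (small) with u(t) = cos(w t + c) and s small, the dual value is, to first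
   order in s, the difference of the integrals of u(<theta, x>) against alpha_n and alpha.  It is
   equicontinuous in theta, and sphere_unif charges every ball around a unit vector, so
   SUOT -> 0 or USOT -> 0 forces convergence of the integrals of cos(<xi, x> + c) for all xi and c; by
   Stone-Weierstrass this is weak convergence on the compact set X.

   Conversely, under weak convergence both quantities are bounded by balanced transport between rescaled
   measures of equal mass, plus the entropy of the rescaling.  In each direction that transport cost
   tends to 0 by Skorohod's theorem on the line, and it is bounded, so its integral tends to 0. *)

theory Submission
  imports Defs
begin

section \<open>Weak duality\<close>

text \<open>The directional costs are infima and are not known to be measurable in \<theta>, so
  integrals over directions are lower integrals: they cannot be split over sums, nor passed to the
  limit directly. Lower bounds therefore use constants on Borel sets of directions, and limits go
  through simple minorants. The dual objective comes from the convex conjugate of the entropy,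
  \<rho> (exp (q / \<rho>) - 1), which is linear at 0 up to a quadratic remainder. Potentials of
  size s thus gain order s and lose order s^2, the loss being proportional to the total masses.
  These masses are not bounded beforehand; the constant potentials \<rho> and -\<rho> provide the
  bound. Cosines are chosen because each sees x through one projection only, is bounded and
  Lipschitz, and because with free phases their span is closed under products. A null limit and null
  members of the sequence cannot be normalised to probability measures and need separate
  competitors.\<close>

lemma ennreal_add_le: "ennreal (x + y) \<le> ennreal x + ennreal y"
proof (cases "0 \<le> x"; cases "0 \<le> y")
  assume "0 \<le> x" "\<not> 0 \<le> y"
  then show ?thesis by (intro order_trans[OF ennreal_leI[of "x + y" x]]) auto
next
  assume "\<not> 0 \<le> x" "0 \<le> y"
  then show ?thesis by (intro order_trans[OF ennreal_leI[of "x + y" y]]) auto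
next
  assume "\<not> 0 \<le> x" "\<not> 0 \<le> y"
  then show ?thesis by (simp add: ennreal_neg)
qed (simp add: ennreal_plus)

text \<open>Passing to the positive part of \<open>g\<close> keeps the pointwise bound, since
  \<open>ennreal\<close> sends negative reals to 0, and turns the Bochner integral into a
  nonnegative one.\<close>

lemma ennreal_integral_le_nn_integral:
  fixes g :: "'b \<Rightarrow> real"
  assumes "integrable M g" "\<And>x. x \<in> space M \<Longrightarrow> ennreal (g x) \<le> k x"
  shows "ennreal (integral\<^sup>L M g) \<le> (\<integral>\<^sup>+ x. k x \<partial>M)"
proof -
  have "integral\<^sup>L M g \<le> integral\<^sup>L M (\<lambda>x. max 0 (g x))"
    using assms(1) by (intro integral_mono) auto
  then have "ennreal (integral\<^sup>L M g) \<le> ennreal (integral\<^sup>L M (\<lambda>x. max 0 (g x)))"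
    by (rule ennreal_leI)
  also have "\<dots> = (\<integral>\<^sup>+ x. ennreal (max 0 (g x)) \<partial>M)"
    using assms(1) by (intro nn_integral_eq_integral[symmetric]) auto
  also have "\<dots> \<le> (\<integral>\<^sup>+ x. k x \<partial>M)"
    using assms(2) by (intro nn_integral_mono) (simp add: max_def ennreal_neg)
  finally show ?thesis .
qed

text \<open>Fenchel-Young inequality: on the half line x \<ge> 0 the convex conjugate of
  \<open>phi_KL \<rho>\<close> at q is \<rho> (exp (q / \<rho>) - 1), used with q = -y. Divided by
  \<rho>, it is ln t \<le> t - 1 at t = exp (-z) / x.\<close>

lemma phi_KL_ge:
  fixes x y :: real
  assumes "\<rho> > 0" "x \<ge> 0"
  shows "\<rho> * (1 - exp (- y / \<rho>)) - x * y \<le> phi_KL \<rho> x"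
proof (cases "x = 0")
  case True
  then show ?thesis using assms by (simp add: phi_KL_def)
next
  case False
  define z where "z = y / \<rho>"
  have y: "y = \<rho> * z" using assms by (simp add: z_def)
  from False assms have x: "x > 0" by simp
  have "ln (exp (- z) / x) \<le> exp (- z) / x - 1"
    using x by (intro ln_le_minus_one) auto
  then have "- z - ln x \<le> exp (- z) / x - 1"
    using x by (simp add: ln_div)
  then have "x * (- z - ln x) \<le> x * (exp (- z) / x - 1)"
    using x by (intro mult_left_mono) auto
  then have "- x * z - x * ln x \<le> exp (- z) - x"
    using x by (simp add: algebra_simps)
  then have "1 - exp (- z) - x * z \<le> x * ln x - x + 1" by simp
  then have "\<rho> * (1 - exp (- z) - x * z) \<le> phi_KL \<rho> x"
    unfolding phi_KL_def using assms by (intro mult_left_mono) auto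
  then show ?thesis using assms by (simp add: y algebra_simps)
qed

lemma finite_measure_integrable_bounded:
  fixes h :: "'b \<Rightarrow> real"
  assumes "finite_measure M" "h \<in> borel_measurable M" "\<And>x. \<bar>h x\<bar> \<le> B"
  shows "integrable M h"
  using finite_measure.integrable_const_bound[OF assms(1), of h B] assms(2,3) by simp

text \<open>The Fenchel-Young inequality, with the density of \<mu> in place of x, is integrated
  against \<nu>; if absolute continuity fails, the divergence is infinite. The bound
  \<open>B\<close> makes \<open>h\<close> and its exponential integrable.\<close>

lemma KLdiv_dual:
  fixes h :: "'b \<Rightarrow> real"
  assumes \<rho>: "\<rho> > 0" and fin: "finite_measure \<mu>" "finite_measure \<nu>"
    and h[measurable]: "h \<in> borel_measurable \<nu>" and B: "\<And>x. \<bar>h x\<bar> \<le> B"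
  shows "ennreal ((\<integral>x. \<rho> * (1 - exp (- h x / \<rho>)) \<partial>\<nu>) - (\<integral>x. h x \<partial>\<mu>)) \<le> KLdiv \<rho> \<mu> \<nu>"
proof (cases "sets \<mu> = sets \<nu> \<and> absolutely_continuous \<nu> \<mu>")
  case False
  then have "KLdiv \<rho> \<mu> \<nu> = \<top>" by (auto simp: KLdiv_def)
  then show ?thesis by simp
next
  case True
  interpret \<mu>: finite_measure \<mu> by fact
  interpret \<nu>: finite_measure \<nu> by fact
  define D where "D = (\<lambda>x. enn2real (RN_deriv \<nu> \<mu> x))"
  have sets: "sets \<mu> = sets \<nu>" and ac: "absolutely_continuous \<nu> \<mu>" using True by auto
  have "h \<in> borel_measurable \<mu>" using h sets by (simp cong: measurable_cong_sets)
  then have int: "integrable \<mu> h"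
    by (rule finite_measure_integrable_bounded[OF fin(1) _ B])
  have intD: "integrable \<nu> (\<lambda>x. D x * h x)"
    using \<nu>.RN_deriv_integrable[OF \<mu>.sigma_finite_measure ac sets h] int unfolding D_def by simp
  have eqD: "(\<integral>x. h x \<partial>\<mu>) = (\<integral>x. D x * h x \<partial>\<nu>)"
    using \<nu>.RN_deriv_integral[OF \<mu>.sigma_finite_measure ac sets h] unfolding D_def by simp
  have le: "\<bar>\<rho> * (1 - exp (- h x / \<rho>))\<bar> \<le> \<rho> * (1 + exp (B / \<rho>))" for x
  proof -
    have "exp (- h x / \<rho>) \<le> exp (B / \<rho>)"
    proof -
      have "- h x / \<rho> \<le> B / \<rho>" using B[of x] \<rho> by (intro divide_right_mono) auto
      then show ?thesis by (subst exp_le_cancel_iff)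
    qed
    moreover have "\<bar>1 - exp (- h x / \<rho>)\<bar> \<le> 1 + exp (- h x / \<rho>)"
      using exp_gt_zero[of "- h x / \<rho>"] by linarith
    ultimately have "\<bar>1 - exp (- h x / \<rho>)\<bar> \<le> 1 + exp (B / \<rho>)" by linarith
    then show ?thesis using \<rho> by (simp add: abs_mult)
  qed
  have intE: "integrable \<nu> (\<lambda>x. \<rho> * (1 - exp (- h x / \<rho>)))"
    by (rule finite_measure_integrable_bounded[OF fin(2) _ le]) measurable
  have "ennreal ((\<integral>x. \<rho> * (1 - exp (- h x / \<rho>)) \<partial>\<nu>) - (\<integral>x. h x \<partial>\<mu>))
      = ennreal (\<integral>x. \<rho> * (1 - exp (- h x / \<rho>)) - D x * h x \<partial>\<nu>)"
    unfolding eqD using intE intD by simp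
  also have "\<dots> \<le> (\<integral>\<^sup>+ x. ennreal (phi_KL \<rho> (D x)) \<partial>\<nu>)"
  proof (rule ennreal_integral_le_nn_integral)
    fix x
    show "ennreal (\<rho> * (1 - exp (- h x / \<rho>)) - D x * h x) \<le> ennreal (phi_KL \<rho> (D x))"
      by (intro ennreal_leI phi_KL_ge \<rho>) (simp add: D_def)
  qed (use intE intD in simp)
  also have "\<dots> = KLdiv \<rho> \<mu> \<nu>" using True by (simp add: KLdiv_def D_def)
  finally show ?thesis .
qed

text \<open>The Kantorovich constraint. Boundedness makes the potentials and their exponentials
  integrable against every finite measure.\<close>

definition dual_feasible :: "real \<Rightarrow> (real \<Rightarrow> real) \<Rightarrow> (real \<Rightarrow> real) \<Rightarrow> bool" where
  "dual_feasible p f g \<longleftrightarrow> f \<in> borel_measurable borel \<and> g \<in> borel_measurable borel \<and>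
    (\<exists>B. \<forall>x. \<bar>f x\<bar> \<le> B \<and> \<bar>g x\<bar> \<le> B) \<and> (\<forall>x y. f x + g y \<le> \<bar>x - y\<bar> powr p)"

text \<open>The dual objective of \<open>UOT\<close> for the projections of \<open>a\<close> and
  \<open>b\<close>, written as integrals over the original space so that its dependence on \<theta>
  can be estimated pointwise.\<close>

definition dual_value ::
    "real \<Rightarrow> (real \<Rightarrow> real) \<Rightarrow> (real \<Rightarrow> real) \<Rightarrow> 'a::euclidean_space measure \<Rightarrow> 'a measure \<Rightarrow> 'a \<Rightarrow> real" where
  "dual_value \<rho> f g a b \<theta> = (\<integral>x. \<rho> * (1 - exp (- f (\<theta> \<bullet> x) / \<rho>)) \<partial>a) + (\<integral>x. \<rho> * (1 - exp (- g (\<theta> \<bullet> x) / \<rho>)) \<partial>b)"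

lemma sets_proj [simp]: "sets (proj \<theta> a) = sets borel"
  by (simp add: proj_def)

lemma measurable_inner_borel:
  "sets a = sets borel \<Longrightarrow> (\<lambda>x. \<theta> \<bullet> x) \<in> borel_measurable a"
  unfolding measurable_cong_sets[OF _ refl]
  by (intro borel_measurable_continuous_onI continuous_intros)

lemma finite_measure_proj:
  "sets a = sets borel \<Longrightarrow> finite_measure a \<Longrightarrow> finite_measure (proj \<theta> a)"
  unfolding proj_def by (intro finite_measure.finite_measure_distr measurable_inner_borel)

lemma integral_proj:
  fixes f :: "real \<Rightarrow> real"
  assumes "sets a = sets borel" "f \<in> borel_measurable borel"
  shows "integral\<^sup>L (proj \<theta> a) f = (\<integral>x. f (\<theta> \<bullet> x) \<partial>a)"
  unfolding proj_def using assms by (intro integral_distr measurable_inner_borel)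

lemma measurable_fst_snd_borel:
  fixes \<pi> :: "(real \<times> real) measure"
  assumes "sets \<pi> = sets borel"
  shows "fst \<in> measurable \<pi> borel" "snd \<in> measurable \<pi> borel"
proof -
  have "sets \<pi> = sets (borel \<Otimes>\<^sub>M borel)" unfolding borel_prod by (rule assms)
  then have "measurable \<pi> (borel :: real measure) = measurable (borel \<Otimes>\<^sub>M borel) borel"
    by (intro measurable_cong_sets refl)
  then show "fst \<in> measurable \<pi> borel" "snd \<in> measurable \<pi> borel" by simp_all
qed

text \<open>Plans in \<open>OT\<close> are constrained only through their marginals, so their
  finiteness has to be read off a marginal, which has the same total mass.\<close>

lemma finite_measure_marginal:
  fixes \<pi> :: "(real \<times> real) measure"
  assumes "sets \<pi> = sets borel" "finite_measure (distr \<pi> borel fst)"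
  shows "finite_measure \<pi>"
proof
  have "emeasure \<pi> (space \<pi>) = emeasure (distr \<pi> borel fst) UNIV"
    using measurable_fst_snd_borel(1)[OF assms(1)] by (simp add: emeasure_distr)
  also have "\<dots> \<noteq> \<infinity>" by (simp add: finite_measure.emeasure_finite[OF assms(2)])
  finally show "emeasure \<pi> (space \<pi>) \<noteq> \<infinity>" .
qed

lemma coupling_dual:
  fixes \<pi> :: "(real \<times> real) measure"
  assumes "dual_feasible p f g" and sets: "sets \<pi> = sets borel" and fin: "finite_measure \<pi>"
  shows "ennreal ((\<integral>x. f x \<partial>distr \<pi> borel fst) + (\<integral>y. g y \<partial>distr \<pi> borel snd))
    \<le> (\<integral>\<^sup>+ z. ennreal (cost1 p z) \<partial>\<pi>)"
proof -
  obtain B where B: "\<And>x. \<bar>f x\<bar> \<le> B" "\<And>x. \<bar>g x\<bar> \<le> B"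
    and [measurable]: "f \<in> borel_measurable borel" "g \<in> borel_measurable borel"
    and le: "\<And>x y. f x + g y \<le> \<bar>x - y\<bar> powr p"
    using assms(1) unfolding dual_feasible_def by blast
  note [measurable] = measurable_fst_snd_borel[OF sets]
  have int: "integrable \<pi> (\<lambda>z. f (fst z))" "integrable \<pi> (\<lambda>z. g (snd z))"
    by (auto intro!: finite_measure_integrable_bounded[OF fin _ B(1)]
        finite_measure_integrable_bounded[OF fin _ B(2)])
  have "(\<integral>x. f x \<partial>distr \<pi> borel fst) + (\<integral>y. g y \<partial>distr \<pi> borel snd)
      = (\<integral>z. f (fst z) + g (snd z) \<partial>\<pi>)"
    using int by (simp add: integral_distr)
  also have "ennreal \<dots> \<le> (\<integral>\<^sup>+ z. ennreal (cost1 p z) \<partial>\<pi>)"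
    using int by (intro ennreal_integral_le_nn_integral) (auto intro!: ennreal_leI le simp: cost1_def)
  finally show ?thesis .
qed

text \<open>Single summands of a dual value may be negative and are then truncated to 0. This makes
  \<open>ennreal\<close> subadditive, which is the direction that lower bounds need.\<close>

lemma ennreal_add3_le:
  assumes "ennreal x \<le> a" "ennreal y \<le> b" "ennreal z \<le> c"
  shows "ennreal (x + y + z) \<le> a + b + c"
proof -
  have "ennreal (x + y + z) \<le> ennreal x + ennreal y + ennreal z"
    using ennreal_add_le[of "x + y" z] add_right_mono[OF ennreal_add_le[of x y], of "ennreal z"]
    by (rule order_trans)
  also have "\<dots> \<le> a + b + c" by (intro add_mono assms)
  finally show ?thesis .
qed

lemma UOT_dual:
  fixes a b :: "'a::euclidean_space measure"
  assumes \<rho>: "\<rho> > 0" and fg: "dual_feasible p f g"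
    and a: "sets a = sets borel" "finite_measure a" and b: "sets b = sets borel" "finite_measure b"
  shows "ennreal (dual_value \<rho> f g a b \<theta>) \<le> UOT \<rho> p (proj \<theta> a) (proj \<theta> b)"
  unfolding UOT_def
proof (rule INF_greatest, clarify)
  fix \<pi> :: "(real \<times> real) measure"
  assume sets: "sets \<pi> = sets borel" and fin: "finite_measure \<pi>"
  obtain B where B: "\<And>x. \<bar>f x\<bar> \<le> B" "\<And>x. \<bar>g x\<bar> \<le> B"
    and [measurable]: "f \<in> borel_measurable borel" "g \<in> borel_measurable borel"
    using fg unfolding dual_feasible_def by blast
  note [measurable] = measurable_fst_snd_borel[OF sets]
  have fin': "finite_measure (distr \<pi> borel fst)" "finite_measure (distr \<pi> borel snd)"
    using fin by (auto intro!: finite_measure.finite_measure_distr)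
  \<comment> \<open>The integrals of \<open>f\<close> and \<open>g\<close> against the marginals of
    \<pi> are added and subtracted: one copy is bounded by the transport cost, the other two by the
    divergences.\<close>
  have *: "dual_value \<rho> f g a b \<theta> =
     ((\<integral>x. f x \<partial>distr \<pi> borel fst) + (\<integral>y. g y \<partial>distr \<pi> borel snd))
     + ((\<integral>x. \<rho> * (1 - exp (- f x / \<rho>)) \<partial>proj \<theta> a) - (\<integral>x. f x \<partial>distr \<pi> borel fst))
     + ((\<integral>x. \<rho> * (1 - exp (- g x / \<rho>)) \<partial>proj \<theta> b) - (\<integral>x. g x \<partial>distr \<pi> borel snd))"
    unfolding dual_value_def using a b by (simp add: integral_proj)
  show "ennreal (dual_value \<rho> f g a b \<theta>) \<le>
      (\<integral>\<^sup>+ z. ennreal (cost1 p z) \<partial>\<pi>) + KLdiv \<rho> (distr \<pi> borel fst) (proj \<theta> a)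
        + KLdiv \<rho> (distr \<pi> borel snd) (proj \<theta> b)"
    unfolding *
    by (intro ennreal_add3_le coupling_dual[OF fg sets fin] KLdiv_dual[OF \<rho> fin'(1) _ _ B(1)]
        KLdiv_dual[OF \<rho> fin'(2) _ _ B(2)])
      (auto intro!: finite_measure_proj a b simp: measurable_cong_sets[OF sets_proj refl])
qed

text \<open>In \<open>USOT\<close> the entropies live on the whole space while the transport is
  one-dimensional. Testing the entropies with the ridge functions f(<\<theta>, x>) and g(<\<theta>,
  x>) makes the integrals against \<mu> and \<nu> cancel and leaves the same dual value as for
  \<open>UOT\<close>.\<close>

lemma OT_KLdiv_dual:
  fixes a b \<mu> \<nu> :: "'a::euclidean_space measure"
  assumes \<rho>: "\<rho> > 0" and fg: "dual_feasible p f g"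
    and a: "sets a = sets borel" "finite_measure a" and b: "sets b = sets borel" "finite_measure b"
    and \<mu>: "sets \<mu> = sets borel" "finite_measure \<mu>" and \<nu>: "sets \<nu> = sets borel" "finite_measure \<nu>"
  shows "ennreal (dual_value \<rho> f g a b \<theta>)
    \<le> OT p (proj \<theta> \<mu>) (proj \<theta> \<nu>) + KLdiv \<rho> \<mu> a + KLdiv \<rho> \<nu> b"
proof -
  obtain B where B: "\<And>x. \<bar>f x\<bar> \<le> B" "\<And>x. \<bar>g x\<bar> \<le> B"
    and [measurable]: "f \<in> borel_measurable borel" "g \<in> borel_measurable borel"
    using fg unfolding dual_feasible_def by blast
  note [measurable] = measurable_inner_borel[OF a(1)] measurable_inner_borel[OF b(1)]
  have 1: "ennreal ((\<integral>x. f (\<theta> \<bullet> x) \<partial>\<mu>) + (\<integral>y. g (\<theta> \<bullet> y) \<partial>\<nu>)) \<le> OT p (proj \<theta> \<mu>) (proj \<theta> \<nu>)"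
    unfolding OT_def
  proof (rule INF_greatest, clarify)
    fix \<pi> :: "(real \<times> real) measure"
    assume sets: "sets \<pi> = sets borel"
      and m: "distr \<pi> borel fst = proj \<theta> \<mu>" "distr \<pi> borel snd = proj \<theta> \<nu>"
    have "finite_measure \<pi>"
      by (rule finite_measure_marginal[OF sets]) (simp only: m finite_measure_proj[OF \<mu>])
    from coupling_dual[OF fg sets this] show
      "ennreal ((\<integral>x. f (\<theta> \<bullet> x) \<partial>\<mu>) + (\<integral>y. g (\<theta> \<bullet> y) \<partial>\<nu>)) \<le> (\<integral>\<^sup>+ z. ennreal (cost1 p z) \<partial>\<pi>)"
      unfolding m using \<mu> \<nu> by (simp add: integral_proj)
  qed
  have *: "dual_value \<rho> f g a b \<theta> =
     ((\<integral>x. f (\<theta> \<bullet> x) \<partial>\<mu>) + (\<integral>y. g (\<theta> \<bullet> y) \<partial>\<nu>))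
     + ((\<integral>x. \<rho> * (1 - exp (- f (\<theta> \<bullet> x) / \<rho>)) \<partial>a) - (\<integral>x. f (\<theta> \<bullet> x) \<partial>\<mu>))
     + ((\<integral>x. \<rho> * (1 - exp (- g (\<theta> \<bullet> x) / \<rho>)) \<partial>b) - (\<integral>y. g (\<theta> \<bullet> y) \<partial>\<nu>))"
    unfolding dual_value_def by simp
  show ?thesis
    unfolding *
    by (intro ennreal_add3_le 1 KLdiv_dual[OF \<rho> \<mu>(2) a(2) _ B(1)] KLdiv_dual[OF \<rho> \<nu>(2) b(2) _ B(2)]) auto
qed

section \<open>The uniform measure on the sphere\<close>

lemma prob_space_sphere_unif: "prob_space (sphere_unif :: 'a::euclidean_space measure)"
proof -
  have "emeasure lborel (ball (0::'a) 1) \<noteq> 0"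
    using open_not_negligible[OF open_ball, of "0::'a" 1]
    by (auto simp: negligible_iff_null_sets null_sets_def)
  then have "prob_space (uniform_measure lborel (ball (0::'a) 1))"
    using emeasure_lborel_ball_finite[of "0::'a" 1] by (intro prob_space_uniform_measure) auto
  then show ?thesis
    unfolding sphere_unif_def by (rule prob_space.prob_space_distr) measurable
qed

lemma sets_sphere_unif [simp]: "sets sphere_unif = sets borel"
  by (simp add: sphere_unif_def)

lemma space_sphere_unif [simp]: "space sphere_unif = UNIV"
  by (simp add: sphere_unif_def)

text \<open>Normalisation sends the origin to 0, so the bound holds for every sample; the transport
  estimates only use directions of norm at most 1.\<close>

lemma AE_sphere_unif_norm_le: "AE \<theta> in sphere_unif. norm (\<theta> :: 'a::euclidean_space) \<le> 1"
proof -
  have "norm (x /\<^sub>R norm x) \<le> 1" for x :: 'a by (cases "x = 0") auto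
  then show ?thesis
    unfolding sphere_unif_def by (subst AE_distr_iff) (auto simp del: norm_scaleR)
qed

text \<open>Normalisation is continuous on the punctured unit ball, so the preimage of the ball
  there is open. It contains \<theta> / 2, and nonempty open sets have positive Lebesgue
  measure.\<close>

lemma emeasure_sphere_unif_ball_pos:
  fixes \<theta> :: "'a::euclidean_space"
  assumes "norm \<theta> = 1" "r > 0"
  shows "emeasure sphere_unif (ball \<theta> r) > 0"
proof -
  let ?U = "(ball 0 1 - {0}) \<inter> (\<lambda>x::'a. x /\<^sub>R norm x) -` ball \<theta> r"
  have "open ?U"
    by (intro continuous_open_preimage continuous_intros) auto
  moreover have "(1/2) *\<^sub>R \<theta> \<in> ?U"
    using assms by (auto simp: dist_norm)
  ultimately have "\<not> negligible ?U" using open_not_negligible by blast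
  moreover have [measurable]: "?U \<in> sets borel" using \<open>open ?U\<close> by auto
  ultimately have "emeasure lborel ?U \<noteq> 0"
    by (auto simp: negligible_iff_null_sets null_sets_def)
  moreover have [measurable]: "(\<lambda>x::'a. x /\<^sub>R norm x) -` ball \<theta> r \<in> sets borel"
    using measurable_sets[of "\<lambda>x::'a. x /\<^sub>R norm x" borel borel "ball \<theta> r"] by simp
  moreover have "emeasure lborel ?U \<le> emeasure lborel (ball 0 1 \<inter> (\<lambda>x::'a. x /\<^sub>R norm x) -` ball \<theta> r)"
    by (intro emeasure_mono) auto
  ultimately have "emeasure lborel (ball 0 1 \<inter> (\<lambda>x::'a. x /\<^sub>R norm x) -` ball \<theta> r) \<noteq> 0"
    by auto
  then show ?thesis
    unfolding sphere_unif_def using emeasure_lborel_ball_finite[of "0::'a" 1]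
    by (subst emeasure_distr) (auto simp: zero_less_iff_neq_zero ennreal_divide_eq_0_iff)
qed

section \<open>Lower bounds by dual values\<close>

text \<open>exp (-z) \<le> 1 / (1 + z) \<le> 1 - z + 2 z^2. The second bound rests on (1 - z + 2
  z^2) (1 + z) = 1 + z^2 (1 + 2 z), whence the threshold -1/2.\<close>

lemma diff_sq_le_one_minus_exp:
  fixes z :: real
  assumes "z \<ge> - 1/2"
  shows "z - 2 * z\<^sup>2 \<le> 1 - exp (- z)"
proof -
  have "1 + z > 0" using assms by simp
  have "exp (- z) * (1 + z) \<le> exp (- z) * exp z"
    using exp_ge_add_one_self[of z] by (intro mult_left_mono) auto
  also have "\<dots> = 1" by (simp add: exp_minus_inverse mult.commute)
  also have "1 \<le> (1 - z + 2 * z\<^sup>2) * (1 + z)"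
  proof -
    have "(1 - z + 2 * z\<^sup>2) * (1 + z) = 1 + z\<^sup>2 * (1 + 2 * z)"
      by (simp add: algebra_simps power2_eq_square)
    then show ?thesis using assms by simp
  qed
  finally have "exp (- z) \<le> 1 - z + 2 * z\<^sup>2"
    using \<open>1 + z > 0\<close> by simp
  then show ?thesis by simp
qed

text \<open>For a small potential the entropic term is the potential itself up to a quadratic loss;
  the uniform bound \<open>c\<close> turns the loss into a constant.\<close>

lemma entropy_dual_ge:
  fixes y :: real
  assumes "\<rho> > 0" "\<bar>y\<bar> \<le> \<rho> / 2" "\<bar>y\<bar> \<le> c"
  shows "y - 2 * c\<^sup>2 / \<rho> \<le> \<rho> * (1 - exp (- y / \<rho>))"
proof -
  have "y / \<rho> \<ge> - 1/2" using assms by (auto simp: field_simps abs_le_iff)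
  from diff_sq_le_one_minus_exp[OF this]
  have "\<rho> * (y / \<rho> - 2 * (y / \<rho>)\<^sup>2) \<le> \<rho> * (1 - exp (- y / \<rho>))"
    using assms by (intro mult_left_mono) auto
  moreover have "\<rho> * (y / \<rho> - 2 * (y / \<rho>)\<^sup>2) = y - 2 * y\<^sup>2 / \<rho>"
    using assms by (simp add: field_simps power2_eq_square)
  moreover have "2 * y\<^sup>2 / \<rho> \<le> 2 * c\<^sup>2 / \<rho>"
    using assms abs_le_square_iff[of y c] by (auto intro!: divide_right_mono)
  ultimately show ?thesis by linarith
qed

text \<open>The directions are tested on Borel sets, where the dual value is bounded below by a constant:
  transport costs are not known to be measurable in the direction, so their integral is a lower integral.\<close>

definition dominates_dual ::
    "real \<Rightarrow> real \<Rightarrow> ennreal \<Rightarrow> 'a::euclidean_space measure \<Rightarrow> 'a measure \<Rightarrow> bool" where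
  "dominates_dual \<rho> p S a b \<longleftrightarrow> (\<forall>f g B k. dual_feasible p f g \<longrightarrow> B \<in> sets borel \<longrightarrow>
     (\<forall>\<theta>\<in>B. k \<le> dual_value \<rho> f g a b \<theta>) \<longrightarrow> ennreal k * emeasure sphere_unif B \<le> S)"

lemma dominates_dual_SUOT:
  fixes a b :: "'a::euclidean_space measure"
  assumes \<rho>: "\<rho> > 0"
    and a: "sets a = sets borel" "finite_measure a" and b: "sets b = sets borel" "finite_measure b"
  shows "dominates_dual \<rho> p (SUOT \<rho> p a b) a b"
  unfolding dominates_dual_def
proof (intro allI impI)
  fix f g B k
  assume fg: "dual_feasible p f g" and B: "B \<in> sets borel"
    and k: "\<forall>\<theta>\<in>B. k \<le> dual_value \<rho> f g a b \<theta>"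
  have "ennreal k * emeasure sphere_unif B = (\<integral>\<^sup>+ \<theta>. ennreal k * indicator B \<theta> \<partial>sphere_unif)"
    using B by (simp add: nn_integral_cmult_indicator)
  also have "\<dots> \<le> SUOT \<rho> p a b"
    unfolding SUOT_def using k
    by (intro nn_integral_mono)
      (auto split: split_indicator intro: order_trans[OF ennreal_leI UOT_dual[OF \<rho> fg a b]])
  finally show "ennreal k * emeasure sphere_unif B \<le> SUOT \<rho> p a b" .
qed

lemma dominates_dual_USOT:
  fixes a b :: "'a::euclidean_space measure"
  assumes \<rho>: "\<rho> > 0"
    and a: "sets a = sets borel" "finite_measure a" and b: "sets b = sets borel" "finite_measure b"
  shows "dominates_dual \<rho> p (USOT \<rho> p a b) a b"
  unfolding dominates_dual_def
proof (intro allI impI)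
  fix f g B k
  assume fg: "dual_feasible p f g" and B: "B \<in> sets borel"
    and k: "\<forall>\<theta>\<in>B. k \<le> dual_value \<rho> f g a b \<theta>"
  interpret S: prob_space "sphere_unif :: 'a measure" by (rule prob_space_sphere_unif)
  show "ennreal k * emeasure sphere_unif B \<le> USOT \<rho> p a b"
    unfolding USOT_def
  proof (rule INF_greatest, clarsimp)
    fix \<mu> \<nu> :: "'a measure"
    assume \<mu>: "sets \<mu> = sets borel" "finite_measure \<mu>" and \<nu>: "sets \<nu> = sets borel" "finite_measure \<nu>"
    define c where "c = KLdiv \<rho> \<mu> a + KLdiv \<rho> \<nu> b"
    have le: "ennreal k \<le> OT p (proj \<theta> \<mu>) (proj \<theta> \<nu>) + c" if "\<theta> \<in> B" for \<theta>
      using ennreal_leI[of k "dual_value \<rho> f g a b \<theta>"] k that OT_KLdiv_dual[OF \<rho> fg a b \<mu> \<nu>, of \<theta>]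
      by (auto simp: c_def add.assoc)
    \<comment> \<open>The lower integral of a sum cannot be split, so the entropy \<open>c\<close>
      is taken off the constant \<open>k\<close> before integrating. Adding it back costs at most
      \<open>c\<close>, since \<open>B\<close> has mass at most 1; the truncated subtraction still
      satisfies k \<le> (k - c) + c.\<close>
    have "ennreal k * emeasure sphere_unif B \<le> (ennreal k - c + c) * emeasure sphere_unif B"
      by (intro mult_right_mono) (auto simp: diff_add_self_ennreal)
    also have "\<dots> \<le> (ennreal k - c) * emeasure sphere_unif B + c"
      using mult_left_mono[OF S.emeasure_le_1, of c B] by (simp add: distrib_right add_left_mono)
    also have "(ennreal k - c) * emeasure sphere_unif B
        = (\<integral>\<^sup>+ \<theta>. (ennreal k - c) * indicator B \<theta> \<partial>sphere_unif)"
      using B by (simp add: nn_integral_cmult_indicator)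
    also have "\<dots> \<le> SOT p \<mu> \<nu>"
      unfolding SOT_def
    proof (rule nn_integral_mono)
      fix \<theta> :: 'a
      show "(ennreal k - c) * indicator B \<theta> \<le> OT p (proj \<theta> \<mu>) (proj \<theta> \<nu>)"
        using le[of \<theta>] by (auto split: split_indicator simp: ennreal_minus_le_iff add.commute)
    qed
    finally show "ennreal k * emeasure sphere_unif B \<le> SOT p \<mu> \<nu> + KLdiv \<rho> \<mu> a + KLdiv \<rho> \<nu> b"
      by (simp add: c_def add.assoc add_right_mono)
  qed
qed

text \<open>Both potentials are multiples of one Lipschitz function; the shift \<open>s * K * \<delta>\<close> absorbs the
  part of the linear modulus that the cost of exponent \<open>p\<close> does not control near the diagonal.\<close>

lemma dual_feasible_lipschitz:
  fixes u :: "real \<Rightarrow> real"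
  assumes [measurable]: "u \<in> borel_measurable borel" and u1: "\<And>x. \<bar>u x\<bar> \<le> 1"
    and lip: "\<And>x y. \<bar>u x - u y\<bar> \<le> K * \<bar>x - y\<bar>"
    and "s > 0" "\<delta> > 0" "K \<ge> 0" "p \<ge> 1" and s: "s * K \<le> \<delta> powr (p - 1)"
  shows "dual_feasible p (\<lambda>x. s * u x) (\<lambda>x. - s * u x - s * K * \<delta>)"
  unfolding dual_feasible_def
proof (intro conjI allI exI[of _ "s + s * K * \<delta>"])
  fix x y :: real
  have su: "\<bar>s * u x\<bar> \<le> s" using u1[of x] \<open>s > 0\<close> by (simp add: abs_mult)
  have "0 \<le> s * K * \<delta>" using \<open>s > 0\<close> \<open>\<delta> > 0\<close> \<open>K \<ge> 0\<close> by simp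
  then show "\<bar>s * u x\<bar> \<le> s + s * K * \<delta>" "\<bar>- s * u x - s * K * \<delta>\<bar> \<le> s + s * K * \<delta>"
    using su by auto
  define t where "t = \<bar>x - y\<bar>"
  have "t \<ge> 0" by (simp add: t_def)
  have "s * (u x - u y) \<le> s * (K * t)"
    using lip[of x y] \<open>s > 0\<close> by (intro mult_left_mono) (auto simp: t_def)
  moreover have "s * (K * t) \<le> s * K * \<delta> + t powr p"
  proof (cases "t \<le> \<delta>")
    case True
    then have "s * K * t \<le> s * K * \<delta>"
      using \<open>s > 0\<close> \<open>K \<ge> 0\<close> by (intro mult_left_mono) auto
    then have "s * (K * t) \<le> s * K * \<delta>" by (simp only: mult.assoc)
    then show ?thesis using powr_ge_zero[of t p] by linarith
  next
    case False
    then have "t > 0" using \<open>\<delta> > 0\<close> by simp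
    \<comment> \<open>Beyond \<delta> the factor t^(p-1) is at least \<delta>^(p-1), so the cost
      alone dominates the linear modulus.\<close>
    have "s * K * t \<le> \<delta> powr (p - 1) * t"
      using s \<open>t \<ge> 0\<close> by (rule mult_right_mono)
    also have "\<dots> \<le> t powr (p - 1) * t"
      using False \<open>\<delta> > 0\<close> \<open>p \<ge> 1\<close> \<open>t > 0\<close> by (intro mult_right_mono powr_mono2) auto
    also have "\<dots> = t powr p"
      using \<open>t > 0\<close> powr_add[of t "p - 1" 1] by simp
    finally show ?thesis using \<open>0 \<le> s * K * \<delta>\<close> by (simp add: mult.assoc)
  qed
  ultimately show "s * u x + (- s * u y - s * K * \<delta>) \<le> \<bar>x - y\<bar> powr p"
    by (simp add: t_def algebra_simps)
qed (auto intro!: borel_measurable_times borel_measurable_diff assms(1))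

text \<open>The three errors, after the factor \<open>s\<close>, are: \<open>K * \<delta>\<close>
  from the shift in the second potential, \<open>K * (R * r)\<close> from turning \<theta> into
  \<theta>0, and the last one from the quadratic loss in the entropy. With \<delta> \<le> 1 both
  potentials are bounded by s (1 + K), which must not exceed \<rho> / 2 for the quadratic
  estimate.\<close>

lemma dual_value_lower:
  fixes a b :: "'a::euclidean_space measure" and u :: "real \<Rightarrow> real"
  assumes u[measurable]: "u \<in> borel_measurable borel" and u1: "\<And>x. \<bar>u x\<bar> \<le> 1"
    and lip: "\<And>x y. \<bar>u x - u y\<bar> \<le> K * \<bar>x - y\<bar>"
    and pos: "\<rho> > 0" "s > 0" "\<delta> > 0" "\<delta> \<le> 1" "K \<ge> 0" and s: "s * (1 + K) \<le> \<rho> / 2"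
    and a: "sets a = sets borel" "finite_measure a" "AE x in a. norm x \<le> R"
    and b: "sets b = sets borel" "finite_measure b" "AE x in b. norm x \<le> R"
    and \<theta>: "norm (\<theta> - \<theta>0) \<le> r"
  shows "s * ((\<integral>x. u (\<theta>0 \<bullet> x) \<partial>a) - (\<integral>x. u (\<theta>0 \<bullet> x) \<partial>b)
      - (K * \<delta> + K * (R * r) + 2 * s * (1 + K)\<^sup>2 / \<rho>) * (measure a (space a) + measure b (space b)))
    \<le> dual_value \<rho> (\<lambda>x. s * u x) (\<lambda>x. - s * u x - s * K * \<delta>) a b \<theta>"
proof -
  note [measurable] = measurable_inner_borel[OF a(1)] measurable_inner_borel[OF b(1)]
  define e where "e = s * (K * \<delta> + K * (R * r) + 2 * s * (1 + K)\<^sup>2 / \<rho>)"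
  have sK: "0 \<le> s * K" "0 \<le> s * K * \<delta>" "s * K * \<delta> \<le> s * K" using pos
    by (auto simp: mult_left_le)
  have su: "\<bar>s * u t\<bar> \<le> s" for t
    using u1[of t] pos by (simp add: abs_mult)
  have f: "\<bar>s * u t\<bar> \<le> s * (1 + K)" for t
    using su[of t] sK by (simp add: algebra_simps)
  have g: "\<bar>- s * u t - s * K * \<delta>\<bar> \<le> s * (1 + K)" for t
    using su[of t] sK by (simp add: algebra_simps)
  have move: "\<bar>s * u (\<theta> \<bullet> x) - s * u (\<theta>0 \<bullet> x)\<bar> \<le> s * (K * (R * r))" if "norm x \<le> R" for x
  proof -
    have "\<bar>\<theta> \<bullet> x - \<theta>0 \<bullet> x\<bar> \<le> norm (\<theta> - \<theta>0) * norm x"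
      using Cauchy_Schwarz_ineq2[of "\<theta> - \<theta>0" x] by (simp add: inner_diff_left)
    also have "\<dots> \<le> r * R"
      using \<theta> that order_trans[OF norm_ge_zero \<theta>] by (intro mult_mono) auto
    finally have "K * \<bar>\<theta> \<bullet> x - \<theta>0 \<bullet> x\<bar> \<le> K * (R * r)"
      using pos by (intro mult_left_mono) (auto simp: mult.commute)
    then have "\<bar>u (\<theta> \<bullet> x) - u (\<theta>0 \<bullet> x)\<bar> \<le> K * (R * r)"
      using lip[of "\<theta> \<bullet> x" "\<theta>0 \<bullet> x"] by simp
    then have "s * \<bar>u (\<theta> \<bullet> x) - u (\<theta>0 \<bullet> x)\<bar> \<le> s * (K * (R * r))"
      using pos by (intro mult_left_mono) auto
    then show ?thesis using pos by (simp add: abs_mult right_diff_distrib[symmetric])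
  qed
  have split: "s * (K * \<delta> + K * (R * r) + 2 * s * (1 + K)\<^sup>2 / \<rho>)
      = s * K * \<delta> + s * (K * (R * r)) + 2 * (s * (1 + K))\<^sup>2 / \<rho>"
  proof -
    have "s * (2 * s * (1 + K)\<^sup>2 / \<rho>) = 2 * (s * (1 + K))\<^sup>2 / \<rho>"
      by (simp add: power_mult_distrib power2_eq_square[of s])
    then show ?thesis by (simp only: distrib_left mult.assoc)
  qed
  have inte: "integrable a (\<lambda>_. e)" "integrable b (\<lambda>_. e)"
    using a(2) b(2) by (simp_all add: finite_measure.integrable_const)
  have intu: "integrable a (\<lambda>x. u (\<theta>0 \<bullet> x))" "integrable b (\<lambda>x. u (\<theta>0 \<bullet> x))"
    by (auto intro!: finite_measure_integrable_bounded[OF a(2) _ u1]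
        finite_measure_integrable_bounded[OF b(2) _ u1])
  have bd: "\<bar>\<rho> * (1 - exp (- y / \<rho>))\<bar> \<le> \<rho> * (1 + exp 1)" if "\<bar>y\<bar> \<le> s * (1 + K)" for y
  proof -
    have "- y / \<rho> \<le> 1" using that s pos by (simp add: field_simps abs_le_iff)
    then have "exp (- y / \<rho>) \<le> exp 1" by (subst exp_le_cancel_iff)
    then have "\<bar>1 - exp (- y / \<rho>)\<bar> \<le> 1 + exp 1"
      using exp_gt_zero[of "- y / \<rho>"] by linarith
    then show ?thesis using pos by (simp add: abs_mult)
  qed
  have "s * (\<integral>x. u (\<theta>0 \<bullet> x) \<partial>a) - e * measure a (space a) = (\<integral>x. s * u (\<theta>0 \<bullet> x) - e \<partial>a)"
    using intu inte by simp
  also have "\<dots> \<le> (\<integral>x. \<rho> * (1 - exp (- (s * u (\<theta> \<bullet> x)) / \<rho>)) \<partial>a)"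
  proof (rule integral_mono_AE)
    show "integrable a (\<lambda>x. \<rho> * (1 - exp (- (s * u (\<theta> \<bullet> x)) / \<rho>)))"
      by (rule finite_measure_integrable_bounded[OF a(2) _ bd[OF f]]) measurable
    show "AE x in a. s * u (\<theta>0 \<bullet> x) - e \<le> \<rho> * (1 - exp (- (s * u (\<theta> \<bullet> x)) / \<rho>))"
      using a(3)
    proof eventually_elim
      fix x :: 'a assume "norm x \<le> R"
      from move[OF this] entropy_dual_ge[OF pos(1) order_trans[OF f s] f, of "\<theta> \<bullet> x"] sK
      show "s * u (\<theta>0 \<bullet> x) - e \<le> \<rho> * (1 - exp (- (s * u (\<theta> \<bullet> x)) / \<rho>))"
        unfolding e_def split by linarith
    qed
  qed (use intu inte in simp)
  finally have A: "s * (\<integral>x. u (\<theta>0 \<bullet> x) \<partial>a) - e * measure a (space a)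
    \<le> (\<integral>x. \<rho> * (1 - exp (- (s * u (\<theta> \<bullet> x)) / \<rho>)) \<partial>a)" .
  have "- s * (\<integral>x. u (\<theta>0 \<bullet> x) \<partial>b) - e * measure b (space b) = (\<integral>x. - s * u (\<theta>0 \<bullet> x) - e \<partial>b)"
    using intu inte by simp
  also have "\<dots> \<le> (\<integral>x. \<rho> * (1 - exp (- (- s * u (\<theta> \<bullet> x) - s * K * \<delta>) / \<rho>)) \<partial>b)"
  proof (rule integral_mono_AE)
    show "integrable b (\<lambda>x. \<rho> * (1 - exp (- (- s * u (\<theta> \<bullet> x) - s * K * \<delta>) / \<rho>)))"
      by (rule finite_measure_integrable_bounded[OF b(2) _ bd[OF g]]) measurable
    show "AE x in b. - s * u (\<theta>0 \<bullet> x) - e \<le> \<rho> * (1 - exp (- (- s * u (\<theta> \<bullet> x) - s * K * \<delta>) / \<rho>))"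
      using b(3)
    proof eventually_elim
      fix x :: 'a assume "norm x \<le> R"
      from move[OF this] entropy_dual_ge[OF pos(1) order_trans[OF g s] g, of "\<theta> \<bullet> x"]
      show "- s * u (\<theta>0 \<bullet> x) - e \<le> \<rho> * (1 - exp (- (- s * u (\<theta> \<bullet> x) - s * K * \<delta>) / \<rho>))"
        unfolding e_def split by linarith
    qed
  qed (use intu inte in simp)
  finally have "- s * (\<integral>x. u (\<theta>0 \<bullet> x) \<partial>b) - e * measure b (space b)
    \<le> (\<integral>x. \<rho> * (1 - exp (- (- s * u (\<theta> \<bullet> x) - s * K * \<delta>) / \<rho>)) \<partial>b)" .
  with A have "(s * (\<integral>x. u (\<theta>0 \<bullet> x) \<partial>a) - e * measure a (space a))
      + (- s * (\<integral>x. u (\<theta>0 \<bullet> x) \<partial>b) - e * measure b (space b))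
    \<le> dual_value \<rho> (\<lambda>x. s * u x) (\<lambda>x. - s * u x - s * K * \<delta>) a b \<theta>"
    unfolding dual_value_def by (rule add_mono)
  moreover have "s * (x - y - E * (m + m')) = (s * x - (s * E) * m) + (- s * y - (s * E) * m')"
    for x y E m m' :: real by (simp add: algebra_simps)
  ultimately show ?thesis unfolding e_def by (simp only:)
qed

text \<open>The constant potentials \<rho> and -\<rho> have a dual value that is the same in every
  direction, so it is compared with \<open>S\<close> over the whole sphere. The resulting mass bound
  controls the errors of \<open>dual_value_lower\<close>, which are proportional to the
  masses.\<close>

lemma dominates_dual_mass:
  fixes a b :: "'a::euclidean_space measure"
  assumes dom: "dominates_dual \<rho> p S a b" and \<rho>: "\<rho> > 0" and p: "p \<ge> 1" and S: "S \<le> 1"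
    and a: "finite_measure a" and b: "finite_measure b"
  shows "\<rho> * (1 - exp (- 1)) * measure a (space a) \<le> 1 + \<rho> * (exp 1 - 1) * measure b (space b)"
proof -
  interpret U: prob_space "sphere_unif :: 'a measure" by (rule prob_space_sphere_unif)
  have fg: "dual_feasible p (\<lambda>_. \<rho>) (\<lambda>_. - \<rho>)"
    unfolding dual_feasible_def by (auto intro!: exI[of _ "\<bar>\<rho>\<bar>"])
  define k where "k = \<rho> * (1 - exp (- 1)) * measure a (space a) - \<rho> * (exp 1 - 1) * measure b (space b)"
  have "dual_value \<rho> (\<lambda>_. \<rho>) (\<lambda>_. - \<rho>) a b \<theta> = k" for \<theta>
    using \<rho> by (simp add: dual_value_def k_def algebra_simps)
  then have "ennreal k * emeasure (sphere_unif :: 'a measure) UNIV \<le> S"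
    using dom fg unfolding dominates_dual_def by auto
  then have "ennreal k \<le> S" using U.emeasure_space_1 by simp
  then have "ennreal k \<le> ennreal 1" unfolding ennreal_1 using S by (rule order_trans)
  then have "k \<le> 1" by (subst (asm) ennreal_le_iff) auto
  then show ?thesis by (simp add: k_def)
qed

text \<open>If the difference were at least \<epsilon>, every direction in a ball around \<theta>
  would have dual value at least s \<epsilon> / 2, and \<open>S n\<close> would be at least a
  positive constant independent of \<open>n\<close>.\<close>

lemma dominates_dual_imp_le:
  fixes as :: "nat \<Rightarrow> 'a::euclidean_space measure" and u :: "real \<Rightarrow> real"
  assumes dom: "\<And>n. dominates_dual \<rho> p (S n) (as n) b" and S: "S \<longlonglongrightarrow> 0"
    and \<rho>: "\<rho> > 0" and p: "p \<ge> 1" and R: "R > 0"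
    and a: "\<And>n. sets (as n) = sets borel" "\<And>n. finite_measure (as n)" "\<And>n. AE x in as n. norm x \<le> R"
    and b: "sets b = sets borel" "finite_measure b" "AE x in b. norm x \<le> R"
    and u[measurable]: "u \<in> borel_measurable borel" and u1: "\<And>x. \<bar>u x\<bar> \<le> 1"
    and lip: "\<And>x y. \<bar>u x - u y\<bar> \<le> K * \<bar>x - y\<bar>" and K: "K > 0"
    and \<theta>: "norm \<theta> = 1" and \<epsilon>: "\<epsilon> > 0"
  shows "\<forall>\<^sub>F n in sequentially. (\<integral>x. u (\<theta> \<bullet> x) \<partial>as n) - (\<integral>x. u (\<theta> \<bullet> x) \<partial>b) < \<epsilon>"
proof -
  define mb where "mb = measure b (space b)"
  \<comment> \<open>A bound for the sum of both masses: the estimate of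
    \<open>dominates_dual_mass\<close> solved for the mass of \<open>as n\<close>, plus
    \<open>mb\<close>.\<close>
  define M where "M = (1 + \<rho> * (exp 1 - 1) * mb) / (\<rho> * (1 - exp (- 1))) + mb"
  have "\<forall>\<^sub>F n in sequentially. S n < 1"
    using S by (rule order_tendstoD) simp
  then have mass: "\<forall>\<^sub>F n in sequentially. measure (as n) (space (as n)) + mb \<le> M"
  proof eventually_elim
    case (elim n)
    then show ?case
      using dominates_dual_mass[OF dom \<rho> p less_imp_le[OF elim] a(2) b(2)] \<rho>
      by (simp add: M_def mb_def field_simps)
  qed
  have "0 < \<rho> * (1 - exp (- 1))" "0 \<le> \<rho> * (exp 1 - 1) * mb" "0 \<le> mb"
    using \<rho> by (auto simp: mb_def)
  then have M: "M > 0" unfolding M_def by (intro add_pos_nonneg divide_pos_pos) auto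
  \<comment> \<open>Each of the three errors, multiplied by \<open>M\<close>, is allotted \<epsilon>
    / 6, so that half of \<epsilon> survives.\<close>
  define \<delta> where "\<delta> = min 1 (\<epsilon> / (6 * K * M))"
  define r where "r = \<epsilon> / (6 * K * R * M)"
  \<comment> \<open>The entries of the minimum ensure, in turn, feasibility of the pair, the range
    \<rho> / 2 of the quadratic estimate, and the share of the second-order error.\<close>
  define s where "s = min (\<delta> powr (p - 1) / K) (min (\<rho> / (2 * (1 + K))) (\<epsilon> * \<rho> / (12 * (1 + K)\<^sup>2 * M)))"
  have \<delta>: "\<delta> > 0" "\<delta> \<le> 1" using \<epsilon> K M by (auto simp: \<delta>_def)
  moreover from \<delta> have "s > 0" using \<epsilon> K M \<rho> by (auto simp: s_def)
  moreover have "r > 0" using \<epsilon> K M R by (simp add: r_def)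
  ultimately have pos: "\<delta> > 0" "\<delta> \<le> 1" "r > 0" "s > 0" by auto
  have s1: "s * K \<le> \<delta> powr (p - 1)"
  proof -
    have "s \<le> \<delta> powr (p - 1) / K" by (simp add: s_def)
    then show ?thesis using K by (simp add: field_simps)
  qed
  have s2: "s * (1 + K) \<le> \<rho> / 2"
  proof -
    have "s \<le> \<rho> / (2 * (1 + K))" by (simp add: s_def)
    then show ?thesis using K by (simp add: field_simps)
  qed
  have "K * \<delta> * M \<le> \<epsilon> / 6"
  proof -
    have "\<delta> \<le> \<epsilon> / (6 * K * M)" by (simp add: \<delta>_def)
    then show ?thesis using K M by (simp add: field_simps)
  qed
  moreover have "K * (R * r) * M = \<epsilon> / 6"
    using K M R by (simp add: r_def)
  moreover have "2 * s * (1 + K)\<^sup>2 / \<rho> * M \<le> \<epsilon> / 6"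
  proof -
    have "s \<le> \<epsilon> * \<rho> / (12 * (1 + K)\<^sup>2 * M)" by (simp add: s_def)
    then show ?thesis using K M \<rho> by (simp add: field_simps)
  qed
  ultimately have err: "(K * \<delta> + K * (R * r) + 2 * s * (1 + K)\<^sup>2 / \<rho>) * M \<le> \<epsilon> / 2"
    by (simp add: distrib_right)
  let ?E = "K * \<delta> + K * (R * r) + 2 * s * (1 + K)\<^sup>2 / \<rho>"
  have E: "?E \<ge> 0" using pos K R \<rho> by simp
  have fg: "dual_feasible p (\<lambda>x. s * u x) (\<lambda>x. - s * u x - s * K * \<delta>)"
    using dual_feasible_lipschitz[OF u u1 lip pos(4,1) _ p s1] K by simp
  have "0 < ennreal (s * (\<epsilon> / 2)) * emeasure sphere_unif (ball \<theta> r)"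
    using pos \<epsilon> emeasure_sphere_unif_ball_pos[OF \<theta> pos(3)] by (simp add: ennreal_zero_less_mult_iff)
  with S have "\<forall>\<^sub>F n in sequentially. S n < ennreal (s * (\<epsilon> / 2)) * emeasure sphere_unif (ball \<theta> r)"
    by (rule order_tendstoD)
  with mass show ?thesis
  proof eventually_elim
    case (elim n)
    show ?case
    proof (rule ccontr)
      assume "\<not> ?thesis"
      then have D: "\<epsilon> \<le> (\<integral>x. u (\<theta> \<bullet> x) \<partial>as n) - (\<integral>x. u (\<theta> \<bullet> x) \<partial>b)" by simp
      have "?E * (measure (as n) (space (as n)) + mb) \<le> \<epsilon> / 2"
        using mult_left_mono[OF elim(1) E] err by linarith
      with D have h: "s * (\<epsilon> / 2) \<le> s * ((\<integral>x. u (\<theta> \<bullet> x) \<partial>as n) - (\<integral>x. u (\<theta> \<bullet> x) \<partial>b)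
          - ?E * (measure (as n) (space (as n)) + mb))"
        using pos by (intro mult_left_mono) auto
      have "s * (\<epsilon> / 2) \<le> dual_value \<rho> (\<lambda>x. s * u x) (\<lambda>x. - s * u x - s * K * \<delta>) (as n) b \<eta>"
        if "\<eta> \<in> ball \<theta> r" for \<eta>
      proof -
        have "norm (\<eta> - \<theta>) \<le> r" using that by (simp add: dist_norm norm_minus_commute)
        from dual_value_lower[OF u u1 lip \<rho> pos(4,1,2) less_imp_le[OF K] s2 a b this]
        show ?thesis by (rule order_trans[OF h[unfolded mb_def]])
      qed
      then have "ennreal (s * (\<epsilon> / 2)) * emeasure sphere_unif (ball \<theta> r) \<le> S n"
        using dom[of n, unfolded dominates_dual_def, rule_format, OF fg, of "ball \<theta> r"] by simp
      with elim(2) show False by simp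
    qed
  qed
qed

lemma abs_cos_diff_le: "\<bar>cos x - cos y\<bar> \<le> \<bar>x - y\<bar>" for x y :: real
proof -
  have "\<bar>cos x - cos y\<bar> = 2 * (\<bar>sin ((x + y) / 2)\<bar> * \<bar>sin ((y - x) / 2)\<bar>)"
    by (simp add: cos_diff_cos abs_mult)
  also have "\<dots> \<le> 2 * (1 * \<bar>(y - x) / 2\<bar>)"
    by (intro mult_left_mono mult_mono abs_sin_x_le_abs_x) auto
  finally show ?thesis by simp
qed

lemma dominates_dual_imp_tendsto_cos:
  fixes as :: "nat \<Rightarrow> 'a::euclidean_space measure"
  assumes dom: "\<And>n. dominates_dual \<rho> p (S n) (as n) b" and S: "S \<longlonglongrightarrow> 0"
    and \<rho>: "\<rho> > 0" and p: "p \<ge> 1" and R: "R > 0"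
    and a: "\<And>n. sets (as n) = sets borel" "\<And>n. finite_measure (as n)" "\<And>n. AE x in as n. norm x \<le> R"
    and b: "sets b = sets borel" "finite_measure b" "AE x in b. norm x \<le> R"
  shows "(\<lambda>n. \<integral>x. cos (\<xi> \<bullet> x + c) \<partial>as n) \<longlonglongrightarrow> (\<integral>x. cos (\<xi> \<bullet> x + c) \<partial>b)"
proof -
  \<comment> \<open>For \<xi> = 0 any unit vector serves, with w = 0; this case carries the
    convergence of the total masses.\<close>
  obtain \<theta> :: 'a and w where \<theta>: "norm \<theta> = 1" and \<xi>: "\<xi> = w *\<^sub>R \<theta>"
  proof (cases "\<xi> = 0")
    case True
    obtain \<theta> :: 'a where "\<theta> \<in> Basis" using nonempty_Basis by blast
    with True that[of \<theta> 0] show thesis by simp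
  next
    case False
    with that[of "\<xi> /\<^sub>R norm \<xi>" "norm \<xi>"] show thesis by simp
  qed
  \<comment> \<open>The constant |w| + 1 stays positive when w = 0, as the one-sided estimate
    requires.\<close>
  have lip: "\<bar>cos (w * x + d) - cos (w * y + d)\<bar> \<le> (\<bar>w\<bar> + 1) * \<bar>x - y\<bar>" for x y d
  proof -
    have "\<bar>cos (w * x + d) - cos (w * y + d)\<bar> \<le> \<bar>(w * x + d) - (w * y + d)\<bar>"
      by (rule abs_cos_diff_le)
    also have "\<dots> = \<bar>w\<bar> * \<bar>x - y\<bar>" by (simp add: abs_mult[symmetric] algebra_simps)
    also have "\<dots> \<le> (\<bar>w\<bar> + 1) * \<bar>x - y\<bar>" by (intro mult_right_mono) auto
    finally show ?thesis .
  qed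
  have le: "\<forall>\<^sub>F n in sequentially. (\<integral>x. cos (\<xi> \<bullet> x + d) \<partial>as n) - (\<integral>x. cos (\<xi> \<bullet> x + d) \<partial>b) < \<epsilon>"
    if "\<epsilon> > 0" for \<epsilon> d
    using dominates_dual_imp_le[OF dom S \<rho> p R a b _ _ lip _ \<theta> that, of d] by (simp add: \<xi>)
  show ?thesis
  proof (rule LIMSEQ_I)
    fix \<epsilon> :: real assume "\<epsilon> > 0"
    have "\<forall>\<^sub>F n in sequentially. norm ((\<integral>x. cos (\<xi> \<bullet> x + c) \<partial>as n) - (\<integral>x. cos (\<xi> \<bullet> x + c) \<partial>b)) < \<epsilon>"
      using le[OF \<open>\<epsilon> > 0\<close>, of c] le[OF \<open>\<epsilon> > 0\<close>, of "c + pi"]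
    proof eventually_elim
      case (elim n)
      \<comment> \<open>A phase shift by pi flips the sign, so the one-sided estimate at both phases
        bounds the absolute value.\<close>
      have "cos (t + (c + pi)) = - cos (t + c)" for t
        by (simp add: add.assoc[symmetric])
      with elim show ?case by auto
    qed
    then show "\<exists>N. \<forall>n\<ge>N. norm ((\<integral>x. cos (\<xi> \<bullet> x + c) \<partial>as n) - (\<integral>x. cos (\<xi> \<bullet> x + c) \<partial>b)) < \<epsilon>"
      by (simp add: eventually_sequentially)
  qed
qed

section \<open>Trigonometric sums\<close>

text \<open>Free phases let cosines stand for sines as well, so the class is closed under products
  by the product-to-sum formula, without complex exponentials.\<close>

inductive trig_sum :: "('a::real_inner \<Rightarrow> real) \<Rightarrow> bool" where
  wave: "trig_sum (\<lambda>x. k * cos (\<xi> \<bullet> x + c))"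
| add: "trig_sum f \<Longrightarrow> trig_sum g \<Longrightarrow> trig_sum (\<lambda>x. f x + g x)"

lemma trig_sum_mult_wave:
  assumes "trig_sum g"
  shows "trig_sum (\<lambda>x. k * cos (\<xi> \<bullet> x + c) * g x)"
  using assms
proof induction
  case (wave k' \<xi>' c')
  have "(\<lambda>x. k * cos (\<xi> \<bullet> x + c) * (k' * cos (\<xi>' \<bullet> x + c')))
      = (\<lambda>x. (k * k' / 2) * cos ((\<xi> - \<xi>') \<bullet> x + (c - c')) + (k * k' / 2) * cos ((\<xi> + \<xi>') \<bullet> x + (c + c')))"
  proof
    fix x
    have "cos (\<xi> \<bullet> x + c) * cos (\<xi>' \<bullet> x + c')
      = (cos ((\<xi> - \<xi>') \<bullet> x + (c - c')) + cos ((\<xi> + \<xi>') \<bullet> x + (c + c'))) / 2"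
      by (simp add: cos_times_cos inner_diff_left inner_add_left algebra_simps)
    then have "(k * k') * (cos (\<xi> \<bullet> x + c) * cos (\<xi>' \<bullet> x + c'))
      = (k * k') * ((cos ((\<xi> - \<xi>') \<bullet> x + (c - c')) + cos ((\<xi> + \<xi>') \<bullet> x + (c + c'))) / 2)"
      by (simp only:)
    then show "k * cos (\<xi> \<bullet> x + c) * (k' * cos (\<xi>' \<bullet> x + c'))
      = (k * k' / 2) * cos ((\<xi> - \<xi>') \<bullet> x + (c - c')) + (k * k' / 2) * cos ((\<xi> + \<xi>') \<bullet> x + (c + c'))"
      by (simp add: algebra_simps)
  qed
  then show ?case by (simp only: trig_sum.intros)
next
  case (add g h)
  then show ?case by (simp only: distrib_left trig_sum.add)
qed

lemma trig_sum_mult: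
  assumes "trig_sum f" "trig_sum g"
  shows "trig_sum (\<lambda>x. f x * g x)"
  using assms(1)
proof induction
  case (wave k \<xi> c)
  show ?case using assms(2) by (rule trig_sum_mult_wave)
next
  case (add f h)
  then show ?case by (simp only: distrib_right trig_sum.add)
qed

lemma trig_sum_continuous: "trig_sum f \<Longrightarrow> continuous_on S f"
  by (induction rule: trig_sum.induct) (auto intro!: continuous_intros)

lemma trig_sum_dense:
  fixes f :: "'a::euclidean_space \<Rightarrow> real"
  assumes "compact X" "continuous_on X f" "e > 0"
  obtains g where "trig_sum g" "\<And>x. x \<in> X \<Longrightarrow> \<bar>f x - g x\<bar> < e"
proof -
  interpret function_ring_on "Collect (trig_sum :: ('a \<Rightarrow> real) \<Rightarrow> bool)" X
  proof
    show "(\<lambda>_. c) \<in> Collect (trig_sum :: ('a \<Rightarrow> real) \<Rightarrow> bool)" for c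
      using trig_sum.wave[of c 0 0] by simp
  next
    fix x y :: 'a assume "x \<noteq> y"
    \<comment> \<open>Scaled so that <\<xi>, x - y> = 1: with phase -<\<xi>, y> the wave takes the
      values cos 1 at x and cos 0 at y.\<close>
    define \<xi> where "\<xi> = (x - y) /\<^sub>R (norm (x - y))\<^sup>2"
    have "\<xi> \<bullet> x + (- (\<xi> \<bullet> y)) = \<xi> \<bullet> (x - y)" by (simp add: inner_diff_right)
    also have "\<dots> = 1" using \<open>x \<noteq> y\<close>
      by (simp add: \<xi>_def power2_norm_eq_inner)
    finally have "cos (\<xi> \<bullet> x + (- (\<xi> \<bullet> y))) = cos 1" by simp
    moreover have "cos 1 < cos (0::real)" using pi_gt3 by (intro cos_monotone_0_pi) auto
    ultimately show "\<exists>f\<in>Collect (trig_sum :: ('a \<Rightarrow> real) \<Rightarrow> bool). f x \<noteq> f y"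
      using trig_sum.wave[of 1 \<xi> "- (\<xi> \<bullet> y)"]
      by (intro bexI[of _ "\<lambda>z. 1 * cos (\<xi> \<bullet> z + - (\<xi> \<bullet> y))"]) auto
  qed (use assms(1) in \<open>auto intro: trig_sum_continuous trig_sum.add trig_sum_mult\<close>)
  from Stone_Weierstrass_basic[OF assms(2,3)] that show thesis by blast
qed

section \<open>Measures on a compact set, and convergence tested on waves\<close>

lemma MplusD:
  assumes "M \<in> Mplus X"
  shows "sets M = sets borel" "finite_measure M" "space M = UNIV"
  using assms sets_eq_imp_space_eq[of M borel] by (auto simp: Mplus_def)

lemma Mplus_AE:
  assumes "M \<in> Mplus X" "closed X"
  shows "AE x in M. x \<in> X"
  using assms MplusD[OF assms(1)]
  by (intro AE_I[of _ _ "UNIV - X"]) (auto simp: Mplus_def)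

text \<open>The test functions of \<open>weak_conv\<close> may be unbounded on the whole space;
  compactness of \<open>X\<close> bounds them almost everywhere.\<close>

lemma Mplus_integrable:
  fixes f :: "'a::euclidean_space \<Rightarrow> real"
  assumes M: "M \<in> Mplus X" and X: "compact X" and f: "continuous_on UNIV f"
  shows "integrable M f"
proof -
  have "bounded (f ` X)"
    using X f by (meson compact_continuous_image compact_imp_bounded continuous_on_subset subset_UNIV)
  then obtain B where B: "\<And>x. x \<in> X \<Longrightarrow> norm (f x) \<le> B" by (auto simp: bounded_iff)
  show ?thesis
  proof (rule finite_measure.integrable_const_bound[OF MplusD(2)[OF M]])
    show "AE x in M. norm (f x) \<le> B"
      using Mplus_AE[OF M compact_imp_closed[OF X]] by eventually_elim (rule B)
    show "f \<in> borel_measurable M"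
      using f unfolding measurable_cong_sets[OF MplusD(1)[OF M] refl]
      by (rule borel_measurable_continuous_onI)
  qed
qed

lemma tendsto_cos_imp_weak_conv:
  fixes as :: "nat \<Rightarrow> 'a::euclidean_space measure"
  assumes a: "\<And>n. as n \<in> Mplus X" and b: "b \<in> Mplus X" and X: "compact X"
    and lim: "\<And>\<xi> c. (\<lambda>n. \<integral>x. cos (\<xi> \<bullet> x + c) \<partial>as n) \<longlonglongrightarrow> (\<integral>x. cos (\<xi> \<bullet> x + c) \<partial>b)"
  shows "Defs.weak_conv as b"
proof -
  have trig: "(\<lambda>n. integral\<^sup>L (as n) g) \<longlonglongrightarrow> integral\<^sup>L b g" if "trig_sum g" for g
    using that
  proof induction
    case (wave k \<xi> c)
    then show ?case using tendsto_mult[OF tendsto_const lim] by simp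
  next
    case (add f g)
    then show ?case
      using Mplus_integrable[OF a X trig_sum_continuous] Mplus_integrable[OF b X trig_sum_continuous]
      by (simp add: tendsto_add)
  qed
  \<comment> \<open>Frequency and phase 0 give the constant 1, so the masses converge and are
    bounded. A uniform approximation on \<open>X\<close> within \<open>e\<close> then changes each
    integral by at most \<open>e * M\<close>.\<close>
  have "(\<lambda>n. measure (as n) UNIV) \<longlonglongrightarrow> measure b UNIV"
    using lim[of 0 0] by (simp add: MplusD(3)[OF a] MplusD(3)[OF b])
  then have "Bseq (\<lambda>n. measure (as n) UNIV)" by (intro convergent_imp_Bseq) (auto simp: convergent_def)
  then obtain M0 where M0: "\<And>n. measure (as n) UNIV \<le> M0" by (auto simp: Bseq_def)
  define M where "M = max M0 (measure b UNIV) + 1"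
  have M: "M > 0" "\<And>n. measure (as n) UNIV \<le> M" "measure b UNIV \<le> M"
    using M0 by (auto simp: M_def add_increasing2 le_max_iff_disj intro: add_nonneg_pos)
  show ?thesis
    unfolding Defs.weak_conv_def
  proof (intro allI impI LIMSEQ_I)
    fix f :: "'a \<Rightarrow> real" and \<epsilon> :: real
    assume f: "continuous_on UNIV f" and "\<epsilon> > 0"
    define e where "e = \<epsilon> / (3 * M)"
    have "e > 0" using M \<open>\<epsilon> > 0\<close> by (simp add: e_def)
    obtain g where g: "trig_sum g" and fg: "\<And>x. x \<in> X \<Longrightarrow> \<bar>f x - g x\<bar> < e"
      using trig_sum_dense[OF X continuous_on_subset[OF f subset_UNIV] \<open>e > 0\<close>] by blast
    have close: "\<bar>integral\<^sup>L N f - integral\<^sup>L N g\<bar> \<le> \<epsilon> / 3"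
      if N: "N \<in> Mplus X" and "measure N UNIV \<le> M" for N
    proof -
      note int = Mplus_integrable[OF N X f] Mplus_integrable[OF N X trig_sum_continuous[OF g]]
      have "\<bar>integral\<^sup>L N f - integral\<^sup>L N g\<bar> = \<bar>\<integral>x. f x - g x \<partial>N\<bar>" using int by simp
      also have "\<dots> \<le> (\<integral>x. \<bar>f x - g x\<bar> \<partial>N)" by simp
      also have "\<dots> \<le> (\<integral>x. e \<partial>N)"
      proof (rule integral_mono_AE)
        show "AE x in N. \<bar>f x - g x\<bar> \<le> e"
          using Mplus_AE[OF N compact_imp_closed[OF X]] by eventually_elim (use fg in force)
      qed (use int in \<open>auto intro: finite_measure.integrable_const[OF MplusD(2)[OF N]]\<close>)
      also have "\<dots> = e * measure N UNIV" by (simp add: MplusD(3)[OF N])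
      also have "\<dots> \<le> e * M" using \<open>e > 0\<close> that(2) by (intro mult_left_mono) auto
      also have "\<dots> = \<epsilon> / 3" using M by (simp add: e_def)
      finally show ?thesis .
    qed
    obtain n0 where n0: "\<And>n. n \<ge> n0 \<Longrightarrow> \<bar>integral\<^sup>L (as n) g - integral\<^sup>L b g\<bar> < \<epsilon> / 3"
      using LIMSEQ_D[OF trig[OF g], of "\<epsilon> / 3"] \<open>\<epsilon> > 0\<close> by auto
    show "\<exists>no. \<forall>n\<ge>no. norm (integral\<^sup>L (as n) f - integral\<^sup>L b f) < \<epsilon>"
    proof (intro exI allI impI)
      fix n assume "n \<ge> n0"
      show "norm (integral\<^sup>L (as n) f - integral\<^sup>L b f) < \<epsilon>"
        using n0[OF \<open>n \<ge> n0\<close>] close[OF a M(2), of n] close[OF b M(3)] by (simp add: abs_if split: if_splits)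
    qed
  qed
qed

section \<open>Upper bounds by rescaling\<close>

lemma phi_KL_nonneg: "\<rho> > 0 \<Longrightarrow> x \<ge> 0 \<Longrightarrow> 0 \<le> phi_KL \<rho> x"
  using phi_KL_ge[of \<rho> x 0] by simp

lemma finite_measure_density_const:
  assumes "finite_measure M"
  shows "finite_measure (density M (\<lambda>_. ennreal c))"
proof
  show "emeasure (density M (\<lambda>_. ennreal c)) (space (density M (\<lambda>_. ennreal c))) \<noteq> \<infinity>"
    using finite_measure.emeasure_finite[OF assms, of "space M"]
    by (simp add: emeasure_density_const ennreal_mult_eq_top_iff)
qed

lemma KLdiv_density_const:
  assumes \<nu>: "finite_measure \<nu>" and "c \<ge> 0"
  shows "KLdiv \<rho> (density \<nu> (\<lambda>_. ennreal c)) \<nu> = ennreal (phi_KL \<rho> c) * emeasure \<nu> (space \<nu>)"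
proof -
  interpret finite_measure "density \<nu> (\<lambda>_. ennreal c)"
    by (rule finite_measure_density_const[OF \<nu>])
  have RN: "AE x in \<nu>. ennreal c = RN_deriv \<nu> (density \<nu> (\<lambda>_. ennreal c)) x"
    by (rule RN_deriv_unique_sigma_finite) (auto intro: sigma_finite_measure)
  have "KLdiv \<rho> (density \<nu> (\<lambda>_. ennreal c)) \<nu>
    = (\<integral>\<^sup>+ x. ennreal (phi_KL \<rho> (enn2real (RN_deriv \<nu> (density \<nu> (\<lambda>_. ennreal c)) x))) \<partial>\<nu>)"
    by (simp add: KLdiv_def absolutely_continuousI_density)
  also have "\<dots> = (\<integral>\<^sup>+ x. ennreal (phi_KL \<rho> c) \<partial>\<nu>)"
  proof (rule nn_integral_cong_AE)
    show "AE x in \<nu>. ennreal (phi_KL \<rho> (enn2real (RN_deriv \<nu> (density \<nu> (\<lambda>_. ennreal c)) x)))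
        = ennreal (phi_KL \<rho> c)"
      using RN
    proof eventually_elim
      case (elim x)
      show ?case unfolding elim[symmetric] using \<open>c \<ge> 0\<close> by simp
    qed
  qed
  finally show ?thesis by simp
qed

text \<open>No measurability is assumed: for a non-measurable integrand the integral is a lower integral,
  which is approximated from below by simple functions obeying the same bounds.\<close>

lemma nn_integral_tendsto_zero:
  fixes h :: "nat \<Rightarrow> 'b \<Rightarrow> ennreal"
  assumes M: "finite_measure M"
    and lim: "AE x in M. (\<lambda>n. h n x) \<longlonglongrightarrow> 0" and bound: "\<And>n. AE x in M. h n x \<le> ennreal C"
  shows "(\<lambda>n. \<integral>\<^sup>+ x. h n x \<partial>M) \<longlonglongrightarrow> 0"
proof -
  interpret finite_measure M by fact
  have C: "(\<integral>\<^sup>+ x. ennreal C \<partial>M) < \<infinity>"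
    by (simp add: emeasure_eq_measure ennreal_mult_less_top)
  \<comment> \<open>The supremum defining the integral is finite thanks to the bound
    \<open>C\<close>, so a simple minorant comes within 1 / (n + 1) of it. Dominated convergence
    applies to these measurable minorants, and the gap vanishes.\<close>
  have "\<exists>g\<in>{g. simple_function M g \<and> g \<le> h n}. integral\<^sup>N M (h n) < integral\<^sup>S M g + ennreal (1 / Suc n)" for n
  proof (rule SUP_approx_ennreal)
    have "integral\<^sup>N M (h n) \<le> (\<integral>\<^sup>+ x. ennreal C \<partial>M)" by (rule nn_integral_mono_AE) (rule bound)
    with C show "integral\<^sup>N M (h n) \<noteq> \<infinity>" by auto
    have "(\<lambda>_. 0) \<in> {g. simple_function M g \<and> g \<le> h n}" by (simp add: le_fun_def)
    then show "{g. simple_function M g \<and> g \<le> h n} \<noteq> {}" by blast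
  qed (simp_all add: nn_integral_def)
  then have "\<forall>n. \<exists>g. simple_function M g \<and> g \<le> h n \<and> integral\<^sup>N M (h n) < integral\<^sup>S M g + ennreal (1 / Suc n)"
    by blast
  from choice[OF this] obtain g where g: "\<And>n. simple_function M (g n)" "\<And>n. g n \<le> h n"
    and gh: "\<And>n. integral\<^sup>N M (h n) < integral\<^sup>S M (g n) + ennreal (1 / Suc n)"
    by blast
  have le: "g n x \<le> h n x" for n x using g(2)[of n] by (simp add: le_fun_def)
  have "(\<lambda>n. integral\<^sup>N M (g n)) \<longlonglongrightarrow> (\<integral>\<^sup>+ x. 0 \<partial>M)"
  proof (rule nn_integral_dominated_convergence[where w = "\<lambda>_. ennreal C"])
    show "AE x in M. g n x \<le> ennreal C" for n
      using bound[of n] by eventually_elim (rule order_trans[OF le])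
    show "AE x in M. (\<lambda>n. g n x) \<longlonglongrightarrow> 0"
      using lim
    proof eventually_elim
      case (elim x)
      show ?case
        by (rule tendsto_sandwich[OF _ _ tendsto_const elim]) (auto simp: le)
    qed
  qed (use g(1) C in \<open>auto intro: borel_measurable_simple_function\<close>)
  moreover have "(\<lambda>n. ennreal (1 / Suc n)) \<longlonglongrightarrow> ennreal 0"
    using LIMSEQ_inverse_real_of_nat by (intro tendsto_ennrealI) (simp add: inverse_eq_divide)
  ultimately have "(\<lambda>n. integral\<^sup>N M (g n) + ennreal (1 / Suc n)) \<longlonglongrightarrow> 0 + 0"
    by (intro tendsto_add) auto
  then have lim0: "(\<lambda>n. integral\<^sup>N M (g n) + ennreal (1 / Suc n)) \<longlonglongrightarrow> 0" by simp
  have "integral\<^sup>N M (h n) \<le> integral\<^sup>N M (g n) + ennreal (1 / Suc n)" for n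
    using gh[of n] unfolding nn_integral_eq_simple_integral[OF g(1)] by (rule less_imp_le)
  then show ?thesis
    by (intro tendsto_sandwich[OF _ _ tendsto_const lim0] always_eventually allI) simp_all
qed

text \<open>Every coupling of \<mu>' and \<nu>' competes in \<open>UOT\<close>, with these two
  measures as its marginals. The entropies are moved to the left to pass to the infimum, which
  requires them to be finite; otherwise the bound is trivial.\<close>

lemma UOT_le_OT_plus_KLdiv:
  assumes "finite_measure \<mu>'"
  shows "UOT \<rho> p \<mu> \<nu> \<le> OT p \<mu>' \<nu>' + (KLdiv \<rho> \<mu>' \<mu> + KLdiv \<rho> \<nu>' \<nu>)" (is "_ \<le> _ + ?k")
proof (cases "?k = \<top>")
  case False
  have "UOT \<rho> p \<mu> \<nu> - ?k \<le> OT p \<mu>' \<nu>'"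
    unfolding OT_def
  proof (rule INF_greatest, clarify)
    fix \<pi> :: "(real \<times> real) measure"
    assume \<pi>: "sets \<pi> = sets borel" "\<mu>' = distr \<pi> borel fst" "\<nu>' = distr \<pi> borel snd"
    have "finite_measure \<pi>"
      using assms \<pi> by (intro finite_measure_marginal) auto
    then have "UOT \<rho> p \<mu> \<nu> \<le> (\<integral>\<^sup>+ z. ennreal (cost1 p z) \<partial>\<pi>) + KLdiv \<rho> (distr \<pi> borel fst) \<mu>
        + KLdiv \<rho> (distr \<pi> borel snd) \<nu>"
      unfolding UOT_def using \<pi> by (intro INF_lower) auto
    then have "UOT \<rho> p \<mu> \<nu> \<le> ?k + (\<integral>\<^sup>+ z. ennreal (cost1 p z) \<partial>\<pi>)"
      unfolding \<pi>(2,3) by (simp only: ac_simps)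
    then show "UOT \<rho> p \<mu> \<nu> - (KLdiv \<rho> (distr \<pi> borel fst) \<mu> + KLdiv \<rho> (distr \<pi> borel snd) \<nu>)
      \<le> (\<integral>\<^sup>+ z. ennreal (cost1 p z) \<partial>\<pi>)"
      using False unfolding \<pi>(2,3) by (simp only: ennreal_minus_le_iff) auto
  qed
  then show ?thesis
    using False by (simp only: ennreal_minus_le_iff) (simp add: add.commute)
qed auto

section \<open>Couplings on the line: rescaling and almost sure representation\<close>

lemma density_const_distr:
  "f \<in> measurable M N \<Longrightarrow> density (distr M N f) (\<lambda>_. c) = distr (density M (\<lambda>_. c)) N f"
  by (rule density_distr) auto

lemma OT_density_const_le:
  fixes \<pi> :: "(real \<times> real) measure"
  assumes \<pi>: "sets \<pi> = sets borel" "distr \<pi> borel fst = \<mu>" "distr \<pi> borel snd = \<nu>"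
  shows "OT p (density \<mu> (\<lambda>_. c)) (density \<nu> (\<lambda>_. c)) \<le> c * (\<integral>\<^sup>+ z. ennreal (cost1 p z) \<partial>\<pi>)"
proof -
  have cost: "(\<lambda>z. ennreal (cost1 p z)) \<in> borel_measurable \<pi>"
    unfolding measurable_cong_sets[OF \<pi>(1) refl] cost1_def borel_prod[symmetric] by measurable
  have "OT p (density \<mu> (\<lambda>_. c)) (density \<nu> (\<lambda>_. c))
      \<le> (\<integral>\<^sup>+ z. ennreal (cost1 p z) \<partial>density \<pi> (\<lambda>_. c))"
    unfolding OT_def using \<pi>
    by (intro INF_lower) (auto simp: density_const_distr measurable_fst_snd_borel[OF \<pi>(1)])
  also have "\<dots> = c * (\<integral>\<^sup>+ z. ennreal (cost1 p z) \<partial>\<pi>)"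
    using cost by (simp add: nn_integral_density nn_integral_cmult)
  finally show ?thesis .
qed

text \<open>The Skorohod variables live on one probability space, so the joint law of
  \<open>Z n\<close> and \<open>Y\<close> is a coupling. The costs converge pointwise to 0 and are
  almost surely at most (2R)^p, hence so do their expectations.\<close>

lemma weak_conv_m_couplings:
  assumes \<mu>: "\<And>n. real_distribution (\<mu> n)" and M: "real_distribution M" and conv: "weak_conv_m \<mu> M"
    and supp: "\<And>n. AE x in \<mu> n. \<bar>x\<bar> \<le> R" "AE x in M. \<bar>x\<bar> \<le> R" and p: "p \<ge> 1"
  obtains \<pi> :: "nat \<Rightarrow> (real \<times> real) measure"
  where "\<And>n. sets (\<pi> n) = sets borel" "\<And>n. distr (\<pi> n) borel fst = \<mu> n" "\<And>n. distr (\<pi> n) borel snd = M"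
    "\<And>n. (\<integral>\<^sup>+ z. ennreal (cost1 p z) \<partial>\<pi> n) \<le> ennreal ((2 * R) powr p)"
    "(\<lambda>n. \<integral>\<^sup>+ z. ennreal (cost1 p z) \<partial>\<pi> n) \<longlonglongrightarrow> 0"
proof -
  from Skorohod[OF \<mu> M conv] obtain \<Omega> :: "real measure" and Z :: "nat \<Rightarrow> real \<Rightarrow> real" and Y
    where \<Omega>: "prob_space \<Omega>" and Z[measurable]: "\<And>n. Z n \<in> borel_measurable \<Omega>"
      and Zd: "\<And>n. distr \<Omega> borel (Z n) = \<mu> n"
      and Y': "Y \<in> measurable \<Omega> lborel" and Yd: "distr \<Omega> borel Y = M"
      and lim: "\<And>x. x \<in> space \<Omega> \<Longrightarrow> (\<lambda>n. Z n x) \<longlonglongrightarrow> Y x"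
    by blast
  interpret prob_space \<Omega> by (rule \<Omega>)
  have Y[measurable]: "Y \<in> borel_measurable \<Omega>" using Y' by simp
  define \<pi> where "\<pi> n = distr \<Omega> borel (\<lambda>\<omega>. (Z n \<omega>, Y \<omega>))" for n
  have pair[measurable]: "(\<lambda>\<omega>. (Z n \<omega>, Y \<omega>)) \<in> borel_measurable \<Omega>" for n
    by (intro borel_measurable_Pair Z Y)
  have costm: "(\<lambda>z. ennreal (cost1 p z)) \<in> borel_measurable borel"
    unfolding cost1_def borel_prod[symmetric] by measurable
  have cost: "(\<integral>\<^sup>+ z. ennreal (cost1 p z) \<partial>\<pi> n) = (\<integral>\<^sup>+ \<omega>. ennreal (\<bar>Z n \<omega> - Y \<omega>\<bar> powr p) \<partial>\<Omega>)" for n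
    unfolding \<pi>_def using costm by (simp add: nn_integral_distr pair cost1_def)
  have AEZ: "AE \<omega> in \<Omega>. \<bar>Z n \<omega>\<bar> \<le> R" for n
    using supp(1)[of n] unfolding Zd[symmetric] by (subst (asm) AE_distr_iff) auto
  have AEY: "AE \<omega> in \<Omega>. \<bar>Y \<omega>\<bar> \<le> R"
    using supp(2) unfolding Yd[symmetric] by (subst (asm) AE_distr_iff) auto
  have bound: "AE \<omega> in \<Omega>. ennreal (\<bar>Z n \<omega> - Y \<omega>\<bar> powr p) \<le> ennreal ((2 * R) powr p)" for n
    using AEZ[of n] AEY
  proof eventually_elim
    case (elim \<omega>)
    then have "\<bar>Z n \<omega> - Y \<omega>\<bar> \<le> 2 * R" by linarith
    then show ?case using p by (intro ennreal_leI powr_mono2) auto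
  qed
  show thesis
  proof
    show "sets (\<pi> n) = sets borel" for n by (simp add: \<pi>_def)
    have fs: "fst \<in> borel_measurable (borel :: (real \<times> real) measure)"
      "snd \<in> borel_measurable (borel :: (real \<times> real) measure)"
      by (rule measurable_fst_snd_borel[OF refl])+
    show "distr (\<pi> n) borel fst = \<mu> n" "distr (\<pi> n) borel snd = M" for n
      unfolding \<pi>_def using fs by (simp_all add: distr_distr comp_def Zd Yd)
    have "(\<integral>\<^sup>+ \<omega>. ennreal (\<bar>Z n \<omega> - Y \<omega>\<bar> powr p) \<partial>\<Omega>) \<le> (\<integral>\<^sup>+ \<omega>. ennreal ((2 * R) powr p) \<partial>\<Omega>)" for n
      using bound by (rule nn_integral_mono_AE)
    then show "(\<integral>\<^sup>+ z. ennreal (cost1 p z) \<partial>\<pi> n) \<le> ennreal ((2 * R) powr p)" for n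
      by (simp add: cost emeasure_space_1)
    show "(\<lambda>n. \<integral>\<^sup>+ z. ennreal (cost1 p z) \<partial>\<pi> n) \<longlonglongrightarrow> 0"
      unfolding cost
    proof (rule nn_integral_tendsto_zero[OF finite_measure_axioms _ bound])
      show "AE \<omega> in \<Omega>. (\<lambda>n. ennreal (\<bar>Z n \<omega> - Y \<omega>\<bar> powr p)) \<longlonglongrightarrow> 0"
      proof (rule AE_I2)
        fix \<omega> assume "\<omega> \<in> space \<Omega>"
        have "(\<lambda>n. \<bar>Z n \<omega> - Y \<omega>\<bar>) \<longlonglongrightarrow> 0"
          using tendsto_rabs[OF tendsto_diff[OF lim[OF \<open>\<omega> \<in> space \<Omega>\<close>] tendsto_const[of "Y \<omega>"]]] by simp
        then have "(\<lambda>n. \<bar>Z n \<omega> - Y \<omega>\<bar> powr p) \<longlonglongrightarrow> 0 powr p"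
          using p by (intro tendsto_powr') auto
        then show "(\<lambda>n. ennreal (\<bar>Z n \<omega> - Y \<omega>\<bar> powr p)) \<longlonglongrightarrow> 0"
          using tendsto_ennrealI[of _ 0] by simp
      qed
    qed
  qed
qed

lemma proj_density_const:
  "sets a = sets borel \<Longrightarrow> proj \<theta> (density a (\<lambda>_. c)) = density (proj \<theta> a) (\<lambda>_. c)"
  unfolding proj_def by (simp add: density_const_distr measurable_inner_borel)

text \<open>The null measure is a coupling. This settles the degenerate masses, for which no
  normalisation exists.\<close>

lemma OT_density_zero: "OT p (density \<mu> (\<lambda>_. 0)) (density \<nu> (\<lambda>_. 0)) = 0"
  if "sets \<mu> = sets borel" "sets \<nu> = sets borel"
proof -
  let ?\<pi> = "null_measure (borel :: (real \<times> real) measure)"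
  have "distr ?\<pi> borel fst = density \<mu> (\<lambda>_. 0)" "distr ?\<pi> borel snd = density \<nu> (\<lambda>_. 0)"
    using that measurable_fst_snd_borel[of ?\<pi>]
    by (auto intro!: measure_eqI simp: emeasure_density emeasure_distr)
  then have "OT p (density \<mu> (\<lambda>_. 0)) (density \<nu> (\<lambda>_. 0)) \<le> (\<integral>\<^sup>+ z. ennreal (cost1 p z) \<partial>?\<pi>)"
    unfolding OT_def by (intro INF_lower) auto
  also have "\<dots> = 0"
    by (subst nn_integral_null_measure) simp
  finally show ?thesis by simp
qed

text \<open>For a measure of mass 0 the factor is 1 / 0 = 0 and the result is null, not a
  probability measure; such measures are treated apart.\<close>

definition normalized :: "'a measure \<Rightarrow> 'a measure" where
  "normalized M = density M (\<lambda>_. ennreal (1 / measure M (space M)))"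

lemma prob_space_normalized:
  assumes "finite_measure M" "measure M (space M) > 0"
  shows "prob_space (normalized M)"
proof
  show "emeasure (normalized M) (space (normalized M)) = 1"
    using assms(2) finite_measure.emeasure_eq_measure[OF assms(1)]
    by (simp add: normalized_def emeasure_density_const ennreal_mult[symmetric])
qed

lemma density_normalized:
  assumes "measure M (space M) > 0" "c \<ge> 0"
  shows "density (normalized M) (\<lambda>_. ennreal (c * measure M (space M))) = density M (\<lambda>_. ennreal c)"
  using assms by (simp add: normalized_def density_density_eq ennreal_mult[symmetric])

lemma sets_normalized [simp]: "sets (normalized M) = sets M"
  by (simp add: normalized_def)

lemma real_distribution_proj:
  assumes "prob_space a" "sets a = sets borel"
  shows "real_distribution (proj \<theta> a)"
  unfolding proj_def
  by (intro prob_space.real_distribution_distr assms measurable_inner_borel)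

lemma AE_proj_normalized_le:
  assumes M: "M \<in> Mplus X" and X: "compact X" "X \<subseteq> cball 0 R" and \<theta>: "norm \<theta> \<le> 1"
  shows "AE t in proj \<theta> (normalized M). \<bar>t\<bar> \<le> R"
proof -
  have "AE x in normalized M. \<bar>\<theta> \<bullet> x\<bar> \<le> R"
    unfolding normalized_def
  proof (subst AE_density, simp, rule AE_mp[OF Mplus_AE[OF M compact_imp_closed[OF X(1)]]], intro AE_I2 impI)
    fix x assume "x \<in> X"
    have "\<bar>\<theta> \<bullet> x\<bar> \<le> norm \<theta> * norm x" by (rule Cauchy_Schwarz_ineq2)
    also have "\<dots> \<le> 1 * R"
      using \<theta> \<open>x \<in> X\<close> X(2) by (intro mult_mono) auto
    finally show "\<bar>\<theta> \<bullet> x\<bar> \<le> R" by simp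
  qed
  then show ?thesis
    unfolding proj_def using measurable_inner_borel[of "normalized M" \<theta>] MplusD(1)[OF M]
    by (subst AE_distr_iff) simp_all
qed

lemma integral_normalized:
  fixes f :: "'a \<Rightarrow> real"
  assumes "f \<in> borel_measurable M"
  shows "integral\<^sup>L (normalized M) f = integral\<^sup>L M f / measure M (space M)"
  using assms by (simp add: normalized_def integral_density)

lemma weak_conv_mass:
  assumes "Defs.weak_conv as b" "\<And>n. as n \<in> Mplus X" "b \<in> Mplus X"
  shows "(\<lambda>n. measure (as n) UNIV) \<longlonglongrightarrow> measure b UNIV"
  using assms(1)[unfolded Defs.weak_conv_def, rule_format, of "\<lambda>_. 1"]
  by (simp add: MplusD(3)[OF assms(2)] MplusD(3)[OF assms(3)])

text \<open>Continuous step functions suffice for weak convergence on the line, and composed with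
  <\<theta>, x> they are admissible in \<open>weak_conv\<close>. Skorohod's theorem needs a
  probability law at every index, so members without mass are replaced by the normalised
  limit.\<close>

lemma weak_conv_m_proj_normalized:
  fixes as :: "nat \<Rightarrow> 'a::euclidean_space measure"
  assumes conv: "Defs.weak_conv as b" and a: "\<And>n. as n \<in> Mplus X" and b: "b \<in> Mplus X"
    and pos: "measure b UNIV > 0"
    and \<mu>: "\<mu> = (\<lambda>n. if measure (as n) UNIV = 0 then normalized b else normalized (as n))"
  shows "weak_conv_m (\<lambda>n. proj \<theta> (\<mu> n)) (proj \<theta> (normalized b))"
    and "\<And>n. real_distribution (proj \<theta> (\<mu> n))" and "real_distribution (proj \<theta> (normalized b))"
proof -
  note sp = MplusD(3)[OF a] MplusD(3)[OF b]
  have sets: "sets (\<mu> n) = sets borel" "sets (normalized b) = sets borel" for n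
    using MplusD(1)[OF a] MplusD(1)[OF b] by (auto simp: \<mu>)
  have pb: "prob_space (normalized b)"
    using pos by (intro prob_space_normalized MplusD(2)[OF b]) (simp add: sp)
  have p\<mu>: "prob_space (\<mu> n)" for n
    using pb unfolding \<mu>
    by (auto intro!: prob_space_normalized MplusD(2)[OF a] simp: sp zero_less_measure_iff)
  show rd: "real_distribution (proj \<theta> (\<mu> n))" "real_distribution (proj \<theta> (normalized b))" for n
    by (rule real_distribution_proj[OF p\<mu> sets(1)] real_distribution_proj[OF pb sets(2)])+
  show "weak_conv_m (\<lambda>n. proj \<theta> (\<mu> n)) (proj \<theta> (normalized b))"
  proof (rule integral_cts_step_conv_imp_weak_conv[OF rd])
    fix x y :: real assume "x < y"
    have cts: "continuous_on UNIV (cts_step x y)"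
      by (intro uniformly_continuous_imp_continuous cts_step_uniformly_continuous \<open>x < y\<close>)
    then have [measurable]: "cts_step x y \<in> borel_measurable borel"
      by (rule borel_measurable_continuous_onI)
    have cont: "continuous_on UNIV (\<lambda>z::'a. cts_step x y (\<theta> \<bullet> z))"
      by (rule continuous_on_compose2[OF cts]) (auto intro!: continuous_intros)
    have meas: "(\<lambda>z. cts_step x y (\<theta> \<bullet> z)) \<in> borel_measurable M" if "sets M = sets borel" for M :: "'a measure"
      unfolding measurable_cong_sets[OF that refl] using cont by (rule borel_measurable_continuous_onI)
    have mass: "(\<lambda>n. measure (as n) UNIV) \<longlonglongrightarrow> measure b UNIV"
      by (rule weak_conv_mass[OF conv a b])
    have "(\<lambda>n. (\<integral>z. cts_step x y (\<theta> \<bullet> z) \<partial>as n) / measure (as n) UNIV)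
        \<longlonglongrightarrow> (\<integral>z. cts_step x y (\<theta> \<bullet> z) \<partial>b) / measure b UNIV"
      using conv cont pos unfolding Defs.weak_conv_def by (intro tendsto_divide mass) auto
    moreover have "\<forall>\<^sub>F n in sequentially. (\<integral>z. cts_step x y (\<theta> \<bullet> z) \<partial>as n) / measure (as n) UNIV
        = integral\<^sup>L (\<mu> n) (\<lambda>z. cts_step x y (\<theta> \<bullet> z))"
      \<comment> \<open>The masses tend to a positive limit, so the replacement occurs only finitely
        often.\<close>
      using order_tendstoD(1)[OF mass pos]
      by eventually_elim (simp add: \<mu> integral_normalized meas MplusD(1)[OF a] sp)
    ultimately have "(\<lambda>n. integral\<^sup>L (\<mu> n) (\<lambda>z. cts_step x y (\<theta> \<bullet> z)))
        \<longlonglongrightarrow> (\<integral>z. cts_step x y (\<theta> \<bullet> z) \<partial>b) / measure b UNIV"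
      by (rule Lim_transform_eventually)
    then show "(\<lambda>n. integral\<^sup>L (proj \<theta> (\<mu> n)) (cts_step x y))
        \<longlonglongrightarrow> integral\<^sup>L (proj \<theta> (normalized b)) (cts_step x y)"
      by (simp add: integral_proj sets integral_normalized meas MplusD(1)[OF b] sp)
  qed
qed

text \<open>The limit is rescaled to the mass of \<open>as n\<close>, and couplings of the
  normalised projections are multiplied by that mass. If it is 0, the factor 0 puts both measures in
  the form of \<open>OT_density_zero\<close>.\<close>

lemma OT_proj_tendsto_zero:
  fixes as :: "nat \<Rightarrow> 'a::euclidean_space measure"
  assumes conv: "Defs.weak_conv as b" and a: "\<And>n. as n \<in> Mplus X" and b: "b \<in> Mplus X"
    and X: "compact X" "X \<subseteq> cball 0 R" and p: "p \<ge> 1" and \<theta>: "norm \<theta> \<le> 1"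
    and pos: "measure b UNIV > 0"
  defines "m \<equiv> \<lambda>n. measure (as n) UNIV"
  defines "T \<equiv> \<lambda>n. OT p (proj \<theta> (density (as n) (\<lambda>_. ennreal (if m n = 0 then 0 else 1))))
    (proj \<theta> (density b (\<lambda>_. ennreal (m n / measure b UNIV))))"
  shows "T \<longlonglongrightarrow> 0" and "T n \<le> ennreal (m n) * ennreal ((2 * R) powr p)"
proof -
  note sets = MplusD(1)[OF a] MplusD(1)[OF b] and sp = MplusD(3)[OF a] MplusD(3)[OF b]
  define \<mu> where "\<mu> = (\<lambda>n. if measure (as n) UNIV = 0 then normalized b else normalized (as n))"
  note wc = weak_conv_m_proj_normalized[OF conv a b pos \<mu>_def, of \<theta>]
  note AEb = AE_proj_normalized_le[OF b X \<theta>]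
  have AE: "AE t in proj \<theta> (\<mu> n). \<bar>t\<bar> \<le> R" for n
    using AE_proj_normalized_le[OF a X \<theta>, of n] AEb
    unfolding \<mu>_def by (cases "measure (as n) UNIV = 0") simp_all
  obtain \<pi> :: "nat \<Rightarrow> (real \<times> real) measure"
    where \<pi>: "\<And>n. sets (\<pi> n) = sets borel" "\<And>n. distr (\<pi> n) borel fst = proj \<theta> (\<mu> n)"
      "\<And>n. distr (\<pi> n) borel snd = proj \<theta> (normalized b)"
    and le: "\<And>n. (\<integral>\<^sup>+ z. ennreal (cost1 p z) \<partial>\<pi> n) \<le> ennreal ((2 * R) powr p)"
    and lim: "(\<lambda>n. \<integral>\<^sup>+ z. ennreal (cost1 p z) \<partial>\<pi> n) \<longlonglongrightarrow> 0"
    using weak_conv_m_couplings[OF wc(2,3,1) AE AEb p] by blast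
  have T: "T n \<le> ennreal (m n) * (\<integral>\<^sup>+ z. ennreal (cost1 p z) \<partial>\<pi> n)" for n
  proof (cases "m n = 0")
    case True
    then show ?thesis
      by (simp add: T_def proj_density_const sets OT_density_zero)
  next
    case False
    then have mn: "m n > 0" by (simp add: m_def zero_less_measure_iff)
    have "density (proj \<theta> (\<mu> n)) (\<lambda>_. ennreal (m n)) = proj \<theta> (density (as n) (\<lambda>_. ennreal 1))"
      using density_normalized[of "as n" 1] mn
      by (simp add: proj_density_const[symmetric] sets \<mu>_def m_def sp)
    moreover have "density (proj \<theta> (normalized b)) (\<lambda>_. ennreal (m n))
        = proj \<theta> (density b (\<lambda>_. ennreal (m n / measure b UNIV)))"
      using density_normalized[of b "m n / measure b UNIV"] mn pos
      by (simp add: proj_density_const[symmetric] sets sp)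
    ultimately show ?thesis
      using OT_density_const_le[OF \<pi>, of p n "ennreal (m n)"] False by (simp add: T_def)
  qed
  show "T n \<le> ennreal (m n) * ennreal ((2 * R) powr p)"
    by (rule order_trans[OF T mult_left_mono[OF le]]) simp
  have "(\<lambda>n. ennreal (m n)) \<longlonglongrightarrow> ennreal (measure b UNIV)"
    unfolding m_def by (intro tendsto_ennrealI weak_conv_mass[OF conv a b])
  then have "(\<lambda>n. ennreal (m n) * (\<integral>\<^sup>+ z. ennreal (cost1 p z) \<partial>\<pi> n)) \<longlonglongrightarrow> ennreal (measure b UNIV) * 0"
    by (intro tendsto_mult_ennreal lim) auto
  then have "(\<lambda>n. ennreal (m n) * (\<integral>\<^sup>+ z. ennreal (cost1 p z) \<partial>\<pi> n)) \<longlonglongrightarrow> 0" by simp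
  then show "T \<longlonglongrightarrow> 0"
    by (rule tendsto_sandwich[OF _ _ tendsto_const, rotated 2]) (simp_all add: T)
qed

section \<open>Competitors of equal mass and the upper bounds\<close>

lemma tendsto_phi_KL_one:
  assumes "f \<longlonglongrightarrow> 1"
  shows "(\<lambda>n. phi_KL \<rho> (f n)) \<longlonglongrightarrow> 0"
proof -
  have "(\<lambda>n. phi_KL \<rho> (f n)) \<longlonglongrightarrow> \<rho> * (1 * ln 1 - 1 + 1)"
    unfolding phi_KL_def by (intro tendsto_intros assms) auto
  then show ?thesis by simp
qed

text \<open>The competitors in the two infima are constant multiples of the given measures with equal mass,
  so that only balanced transport between rescaled projections remains.\<close>

lemma weak_conv_imp_competitors:
  fixes as :: "nat \<Rightarrow> 'a::euclidean_space measure"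
  assumes conv: "Defs.weak_conv as b" and a: "\<And>n. as n \<in> Mplus X" and b: "b \<in> Mplus X"
    and X: "compact X" "X \<subseteq> cball 0 R" and p: "p \<ge> 1" and \<rho>: "\<rho> > 0"
  obtains c d e :: "nat \<Rightarrow> real" and C where
    "\<And>n. c n \<ge> 0" "\<And>n. d n \<ge> 0"
    "\<And>n. phi_KL \<rho> (c n) * measure (as n) UNIV + phi_KL \<rho> (d n) * measure b UNIV = e n" "e \<longlonglongrightarrow> 0"
    "\<And>\<theta>. norm \<theta> \<le> 1 \<Longrightarrow> (\<lambda>n. OT p (proj \<theta> (density (as n) (\<lambda>_. ennreal (c n))))
       (proj \<theta> (density b (\<lambda>_. ennreal (d n))))) \<longlonglongrightarrow> 0"
    "\<And>\<theta> n. norm \<theta> \<le> 1 \<Longrightarrow> OT p (proj \<theta> (density (as n) (\<lambda>_. ennreal (c n))))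
       (proj \<theta> (density b (\<lambda>_. ennreal (d n)))) \<le> ennreal C"
proof (cases "measure b UNIV = 0")
  case True
  note mass = weak_conv_mass[OF conv a b]
  \<comment> \<open>With a null limit both measures are scaled to 0. Destroying \<open>as n\<close>
    costs \<rho> times its mass, because \<open>phi_KL \<rho> 0\<close> is \<rho>, and that mass
    tends to 0.\<close>
  show thesis
  proof (rule that[of "\<lambda>_. 0" "\<lambda>_. 0" "\<lambda>n. \<rho> * measure (as n) UNIV" 0])
    show "(\<lambda>n. \<rho> * measure (as n) UNIV) \<longlonglongrightarrow> 0"
      using tendsto_mult[OF tendsto_const[of \<rho>] mass] True by simp
  qed (simp_all add: True phi_KL_def proj_density_const OT_density_zero MplusD(1)[OF a] MplusD(1)[OF b])
next
  case False
  then have pos: "measure b UNIV > 0" by (simp add: zero_less_measure_iff)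
  note mass = weak_conv_mass[OF conv a b]
  then have "Bseq (\<lambda>n. measure (as n) UNIV)"
    by (intro convergent_imp_Bseq) (auto simp: convergent_def)
  then obtain M where M: "\<And>n. measure (as n) UNIV \<le> M" by (auto simp: Bseq_def)
  note OT = OT_proj_tendsto_zero[OF conv a b X p _ pos]
  \<comment> \<open>Only the limit is really rescaled: \<open>phi_KL\<close> vanishes at 1, and the
    factor 0 occurs only against mass 0. The remaining entropy is that of the mass ratio, which
    tends to 1.\<close>
  show thesis
  proof (rule that[of "\<lambda>n. if measure (as n) UNIV = 0 then 0 else 1" "\<lambda>n. measure (as n) UNIV / measure b UNIV"
        "\<lambda>n. phi_KL \<rho> (measure (as n) UNIV / measure b UNIV) * measure b UNIV" "M * (2 * R) powr p"])
    have "(\<lambda>n. measure (as n) UNIV / measure b UNIV) \<longlonglongrightarrow> 1"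
      using tendsto_divide[OF mass tendsto_const[of "measure b UNIV"]] pos by simp
    then show "(\<lambda>n. phi_KL \<rho> (measure (as n) UNIV / measure b UNIV) * measure b UNIV) \<longlonglongrightarrow> 0"
      using tendsto_mult[OF tendsto_phi_KL_one tendsto_const[of "measure b UNIV"]] by simp
    show "phi_KL \<rho> (if measure (as n) UNIV = 0 then 0 else 1) * measure (as n) UNIV
        + phi_KL \<rho> (measure (as n) UNIV / measure b UNIV) * measure b UNIV
      = phi_KL \<rho> (measure (as n) UNIV / measure b UNIV) * measure b UNIV" for n
      by (simp add: phi_KL_def)
    fix \<theta> :: 'a assume \<theta>: "norm \<theta> \<le> 1"
    show "(\<lambda>n. OT p (proj \<theta> (density (as n) (\<lambda>_. ennreal (if measure (as n) UNIV = 0 then 0 else 1))))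
       (proj \<theta> (density b (\<lambda>_. ennreal (measure (as n) UNIV / measure b UNIV))))) \<longlonglongrightarrow> 0"
      by (rule OT(1)[OF \<theta>])
    fix n
    have "ennreal (measure (as n) UNIV) * ennreal ((2 * R) powr p) \<le> ennreal (M * (2 * R) powr p)"
      by (simp add: ennreal_mult[symmetric] M mult_right_mono ennreal_leI)
    then show "OT p (proj \<theta> (density (as n) (\<lambda>_. ennreal (if measure (as n) UNIV = 0 then 0 else 1))))
       (proj \<theta> (density b (\<lambda>_. ennreal (measure (as n) UNIV / measure b UNIV)))) \<le> ennreal (M * (2 * R) powr p)"
      by (rule order_trans[OF OT(2)[OF \<theta>]])
  qed simp_all
qed

lemma KLdiv_sum_density_const:
  assumes "finite_measure a" "finite_measure b" "c \<ge> 0" "d \<ge> 0" "\<rho> > 0"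
  shows "KLdiv \<rho> (density a (\<lambda>_. ennreal c)) a + KLdiv \<rho> (density b (\<lambda>_. ennreal d)) b
    = ennreal (phi_KL \<rho> c * measure a (space a) + phi_KL \<rho> d * measure b (space b))"
  using assms phi_KL_nonneg[of \<rho> c] phi_KL_nonneg[of \<rho> d]
  by (simp add: KLdiv_density_const finite_measure.emeasure_eq_measure ennreal_mult ennreal_plus)

text \<open>One pair of rescaled measures serves both costs: through its projections in each
  direction for \<open>SUOT\<close>, and as it stands for \<open>USOT\<close>, where the pair must
  be the same for all directions.\<close>

lemma
  fixes as :: "nat \<Rightarrow> 'a::euclidean_space measure"
  assumes conv: "Defs.weak_conv as b" and a: "\<And>n. as n \<in> Mplus X" and b: "b \<in> Mplus X"
    and X: "compact X" "X \<subseteq> cball 0 R" and p: "p \<ge> 1" and \<rho>: "\<rho> > 0"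
  shows weak_conv_imp_SUOT_tendsto: "(\<lambda>n. SUOT \<rho> p (as n) b) \<longlonglongrightarrow> 0"
    and weak_conv_imp_USOT_tendsto: "(\<lambda>n. USOT \<rho> p (as n) b) \<longlonglongrightarrow> 0"
proof -
  obtain c d e :: "nat \<Rightarrow> real" and C where cd: "\<And>n. c n \<ge> 0" "\<And>n. d n \<ge> 0"
    and e: "\<And>n. phi_KL \<rho> (c n) * measure (as n) UNIV + phi_KL \<rho> (d n) * measure b UNIV = e n" "e \<longlonglongrightarrow> 0"
    and lim: "\<And>\<theta>. norm \<theta> \<le> 1 \<Longrightarrow> (\<lambda>n. OT p (proj \<theta> (density (as n) (\<lambda>_. ennreal (c n))))
       (proj \<theta> (density b (\<lambda>_. ennreal (d n))))) \<longlonglongrightarrow> 0"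
    and bound: "\<And>\<theta> n. norm \<theta> \<le> 1 \<Longrightarrow> OT p (proj \<theta> (density (as n) (\<lambda>_. ennreal (c n))))
       (proj \<theta> (density b (\<lambda>_. ennreal (d n)))) \<le> ennreal C"
    by (rule weak_conv_imp_competitors[OF conv a b X p \<rho>]) blast
  note A = MplusD[OF a] and B = MplusD[OF b]
  interpret S: prob_space "sphere_unif :: 'a measure" by (rule prob_space_sphere_unif)
  have e0: "(\<lambda>n. ennreal (e n)) \<longlonglongrightarrow> 0"
    using tendsto_ennrealI[OF e(2)] by simp
  have "Bseq e" using e(2) by (intro convergent_imp_Bseq) (auto simp: convergent_def)
  then obtain E where "\<And>n. norm (e n) \<le> E" by (auto simp: Bseq_def)
  then have E: "e n \<le> E" for n using norm_ge_zero[of "e n"] by (simp add: abs_le_iff)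
  define A' where "A' n = density (as n) (\<lambda>_. ennreal (c n))" for n
  define B' where "B' n = density b (\<lambda>_. ennreal (d n))" for n
  have fin: "finite_measure (A' n)" "finite_measure (B' n)"
    and sets: "sets (A' n) = sets borel" "sets (B' n) = sets borel" for n
    using A B by (auto simp: A'_def B'_def intro: finite_measure_density_const)
  \<comment> \<open>Projection commutes with constant densities and preserves total mass, so the
    entropy equals \<open>e n\<close> in every direction.\<close>
  have UOT: "UOT \<rho> p (proj \<theta> (as n)) (proj \<theta> b) \<le> OT p (proj \<theta> (A' n)) (proj \<theta> (B' n)) + ennreal (e n)"
    for \<theta> n
  proof -
    have "measure (proj \<theta> a) UNIV = measure a UNIV" if "sets a = sets borel" "space a = UNIV" for a :: "'a measure"
      using that by (simp add: proj_def measure_distr measurable_inner_borel)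
    moreover have "space (proj \<theta> a) = UNIV" for a :: "'a measure" by (simp add: proj_def)
    ultimately have "KLdiv \<rho> (proj \<theta> (A' n)) (proj \<theta> (as n)) + KLdiv \<rho> (proj \<theta> (B' n)) (proj \<theta> b) = ennreal (e n)"
      unfolding A'_def B'_def using A B e(1)[of n]
      by (simp add: proj_density_const KLdiv_sum_density_const finite_measure_proj cd \<rho>)
    then show ?thesis
      using UOT_le_OT_plus_KLdiv[OF finite_measure_proj[OF sets(1) fin(1)],
          of \<rho> p "proj \<theta> (as n)" "proj \<theta> b" \<theta> n "proj \<theta> (B' n)"] by simp
  qed
  show "(\<lambda>n. SUOT \<rho> p (as n) b) \<longlonglongrightarrow> 0"
    unfolding SUOT_def
  proof (rule nn_integral_tendsto_zero[OF S.finite_measure_axioms])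
    show "AE \<theta> in sphere_unif. (\<lambda>n. UOT \<rho> p (proj \<theta> (as n)) (proj \<theta> b)) \<longlonglongrightarrow> 0"
      using AE_sphere_unif_norm_le
    proof eventually_elim
      fix \<theta> :: 'a assume "norm \<theta> \<le> 1"
      then have "(\<lambda>n. OT p (proj \<theta> (A' n)) (proj \<theta> (B' n)) + ennreal (e n)) \<longlonglongrightarrow> 0 + 0"
        unfolding A'_def B'_def by (intro tendsto_add lim e0)
      then have "(\<lambda>n. OT p (proj \<theta> (A' n)) (proj \<theta> (B' n)) + ennreal (e n)) \<longlonglongrightarrow> 0" by simp
      then show "(\<lambda>n. UOT \<rho> p (proj \<theta> (as n)) (proj \<theta> b)) \<longlonglongrightarrow> 0"
        by (rule tendsto_sandwich[OF _ _ tendsto_const, rotated 2]) (simp_all add: UOT)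
    qed
    show "AE \<theta> in sphere_unif. UOT \<rho> p (proj \<theta> (as n)) (proj \<theta> b) \<le> ennreal (\<bar>C\<bar> + \<bar>E\<bar>)" for n
      using AE_sphere_unif_norm_le
    proof eventually_elim
      fix \<theta> :: 'a assume "norm \<theta> \<le> 1"
      have "OT p (proj \<theta> (A' n)) (proj \<theta> (B' n)) \<le> ennreal \<bar>C\<bar>"
        using bound[OF \<open>norm \<theta> \<le> 1\<close>, of n] unfolding A'_def B'_def
        by (rule order_trans) (simp add: ennreal_leI)
      moreover have "ennreal (e n) \<le> ennreal \<bar>E\<bar>" using E[of n] by (intro ennreal_leI) linarith
      ultimately have "OT p (proj \<theta> (A' n)) (proj \<theta> (B' n)) + ennreal (e n) \<le> ennreal (\<bar>C\<bar> + \<bar>E\<bar>)"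
        unfolding ennreal_plus[OF abs_ge_zero abs_ge_zero] by (rule add_mono)
      with UOT show "UOT \<rho> p (proj \<theta> (as n)) (proj \<theta> b) \<le> ennreal (\<bar>C\<bar> + \<bar>E\<bar>)"
        by (rule order_trans)
    qed
  qed
  have SOT: "(\<lambda>n. SOT p (A' n) (B' n)) \<longlonglongrightarrow> 0"
    unfolding SOT_def
  proof (rule nn_integral_tendsto_zero[OF S.finite_measure_axioms])
    show "AE \<theta> in sphere_unif. (\<lambda>n. OT p (proj \<theta> (A' n)) (proj \<theta> (B' n))) \<longlonglongrightarrow> 0"
      using AE_sphere_unif_norm_le unfolding A'_def B'_def by eventually_elim (rule lim)
    show "AE \<theta> in sphere_unif. OT p (proj \<theta> (A' n)) (proj \<theta> (B' n)) \<le> ennreal C" for n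
      using AE_sphere_unif_norm_le unfolding A'_def B'_def by eventually_elim (rule bound)
  qed
  have USOT: "USOT \<rho> p (as n) b \<le> SOT p (A' n) (B' n) + ennreal (e n)" for n
  proof -
    have "USOT \<rho> p (as n) b \<le> SOT p (A' n) (B' n) + KLdiv \<rho> (A' n) (as n) + KLdiv \<rho> (B' n) b"
      unfolding USOT_def using fin sets by (intro INF_lower2[of "(A' n, B' n)"]) auto
    also have "\<dots> = SOT p (A' n) (B' n) + (KLdiv \<rho> (A' n) (as n) + KLdiv \<rho> (B' n) b)"
      by (rule add.assoc)
    also have "KLdiv \<rho> (A' n) (as n) + KLdiv \<rho> (B' n) b = ennreal (e n)"
      unfolding A'_def B'_def using A B e(1)[of n] by (simp add: KLdiv_sum_density_const cd \<rho>)
    finally show ?thesis .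
  qed
  have "(\<lambda>n. SOT p (A' n) (B' n) + ennreal (e n)) \<longlonglongrightarrow> 0"
    using tendsto_add[OF SOT e0] by simp
  then show "(\<lambda>n. USOT \<rho> p (as n) b) \<longlonglongrightarrow> 0"
    by (rule tendsto_sandwich[OF _ _ tendsto_const, rotated 2]) (simp_all add: USOT)
qed

section \<open>Equivalence with weak convergence\<close>

lemma dominates_dual_imp_weak_conv:
  fixes as :: "nat \<Rightarrow> 'a::euclidean_space measure"
  assumes dom: "\<And>n. dominates_dual \<rho> p (S n) (as n) b" and S: "S \<longlonglongrightarrow> 0"
    and a: "\<And>n. as n \<in> Mplus X" and b: "b \<in> Mplus X"
    and X: "compact X" "X \<subseteq> cball 0 R" and p: "p \<ge> 1" and \<rho>: "\<rho> > 0" and R: "R > 0"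
  shows "Defs.weak_conv as b"
proof (rule tendsto_cos_imp_weak_conv[OF a b X(1)])
  have AE: "AE x in M. norm x \<le> R" if "M \<in> Mplus X" for M :: "'a measure"
    using Mplus_AE[OF that compact_imp_closed[OF X(1)]] by eventually_elim (use X(2) in auto)
  show "(\<lambda>n. \<integral>x. cos (\<xi> \<bullet> x + c) \<partial>as n) \<longlonglongrightarrow> (\<integral>x. cos (\<xi> \<bullet> x + c) \<partial>b)" for \<xi> c
    by (rule dominates_dual_imp_tendsto_cos[OF dom S \<rho> p R MplusD(1,2)[OF a] AE[OF a]
          MplusD(1,2)[OF b] AE[OF b]])
qed

theorem theorem2:
  fixes \<rho> p R :: real and X :: "'a::euclidean_space set"
    and \<alpha>s :: "nat \<Rightarrow> 'a measure" and \<alpha> :: "'a measure"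
  assumes "\<rho> > 0" and "p \<ge> 1" and "R > 0"
    and "compact X" and "X \<subseteq> cball 0 R"
    and "\<And>n. \<alpha>s n \<in> Mplus X" and "\<alpha> \<in> Mplus X"
  shows "(weak_conv \<alpha>s \<alpha> \<longleftrightarrow> (\<lambda>n. SUOT \<rho> p (\<alpha>s n) \<alpha>) \<longlonglongrightarrow> 0)
       \<and> ((\<lambda>n. SUOT \<rho> p (\<alpha>s n) \<alpha>) \<longlonglongrightarrow> 0 \<longleftrightarrow> (\<lambda>n. USOT \<rho> p (\<alpha>s n) \<alpha>) \<longlonglongrightarrow> 0)"
proof -
  note dom = MplusD(1,2)[OF assms(6)] MplusD(1,2)[OF assms(7)]
  note SUOT_imp = dominates_dual_imp_weak_conv[OF dominates_dual_SUOT[OF assms(1) dom] _ assms(6,7,4,5,2,1,3)]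
  note USOT_imp = dominates_dual_imp_weak_conv[OF dominates_dual_USOT[OF assms(1) dom] _ assms(6,7,4,5,2,1,3)]
  note imp_SUOT = weak_conv_imp_SUOT_tendsto[of \<alpha>s, OF _ assms(6,7,4,5,2,1)]
  note imp_USOT = weak_conv_imp_USOT_tendsto[of \<alpha>s, OF _ assms(6,7,4,5,2,1)]
  show ?thesis
    \<comment> \<open>The two sliced costs are never compared directly; both implications between
      them pass through weak convergence.\<close>
    by (intro conjI iffI)
      (erule imp_SUOT, erule SUOT_imp, rule imp_USOT, erule SUOT_imp, rule imp_SUOT, erule USOT_imp)
qed

end
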